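(* Fix an odd positive integer $\ell$. For $n\ge 3$ and $1\le k\le n$, define $p_\ell^{(k)}:S^{n-1}\to\mathbb{R}$ by $p_\ell^{(k)}(x)=A\,C_\ell^{\frac{n-2}{2}}(x_k)$, where $$A^2=\frac{(n-3)!\,\ell!\,(n+2\ell-2)}{(n+\ell-3)!\,(n-2)}$$ and $C^{\kappa}_\ell$ is the Gegenbauer polynomial $$C^\kappa_\ell(t)=\frac{2^\ell}{\Gamma(\kappa)}\sum_{j=0}^{\lfloor \ell/2\rfloor}\frac{(-1)^j\Gamma(\kappa+\ell-j)}{2^{2j}j!(\ell-2j)!}t^{\ell-2j}.$$ Then there is a constant $c$ depending only on $\ell$ such that for every $n\ge3$ and every $\mathbf a=(a_1,\dots,a_n)\in\mathbb{R}^n$ with $\sum a_i^2=1$, the function $p(x)=\sum_{i=1}^n a_ip_\ell^{(i)}(x)$ satisfies $$d_{TV}(p(X),Z)\le c\|\mathbf a\|_4^2,$$ where $X$ is a uniformly random point of $S^{n-1}$, $Z$ is a standard Gaussian random variable, and $\|\mathbf a\|_4=(\sum_i a_i^4)^{1/4}$. Moreover, there is a constant $c'$ depending only on $\ell$ such that if the coefficient vector $\mathbf a$ is chosen uniformly at random from $S^{n-1}$ (independently of $X$), then $$\mathbb{E}\,d_{TV}(p(X),Z)\le\frac{c'}{\sqrt n},$$ where the total variation distance is computed for fixed $\mathbf a$ and the expectation is over $\mathbf a$.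
   Context: $S^{n-1}$ carries the uniform probability measure. Each $p_\ell^{(k)}$ is a spherical harmonic of degree $\ell$ (eigenfunction of the spherical Laplacian with eigenvalue $-\ell(n+\ell-2)$) with $\mathbb{E}[p_\ell^{(k)}(X)^2]=1$. $d_{TV}(X,Y)=\sup_A|\mathbb{P}(X\in A)-\mathbb{P}(Y\in A)|$ over measurable $A$. *)

theory Defs
  imports "HOL-Probability.Probability"
begin

text \<open>Points of R^n are represented as functions nat => real, extensional on {..<n}.\<close>

definition eucl_norm :: "nat \<Rightarrow> (nat \<Rightarrow> real) \<Rightarrow> real" where
  "eucl_norm n x = sqrt (\<Sum>i<n. (x i)^2)"

definition lebesgue_Rn :: "nat \<Rightarrow> (nat \<Rightarrow> real) measure" where
  "lebesgue_Rn n = PiM {..<n} (\<lambda>_. lborel)"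

definition unit_ball :: "nat \<Rightarrow> (nat \<Rightarrow> real) set" where
  "unit_ball n = {x \<in> PiE {..<n} (\<lambda>_. UNIV). eucl_norm n x \<le> 1}"

text \<open>Uniform (normalized surface / cone) probability measure on S^{n-1}:
  the image of the uniform distribution on the unit ball under radial projection
  x \<mapsto> x / |x|.\<close>
definition sphere_unif :: "nat \<Rightarrow> (nat \<Rightarrow> real) measure" where
  "sphere_unif n = distr (uniform_measure (lebesgue_Rn n) (unit_ball n)) (lebesgue_Rn n)
     (\<lambda>x. \<lambda>i\<in>{..<n}. x i / eucl_norm n x)"

definition gegenbauer :: "real \<Rightarrow> nat \<Rightarrow> real \<Rightarrow> real" where
  "gegenbauer \<kappa> l t = 2 ^ l / Gamma \<kappa> *
     (\<Sum>j\<le>l div 2. (-1) ^ j * Gamma (\<kappa> + real l - real j) /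
        (2 ^ (2 * j) * fact j * fact (l - 2 * j)) * t ^ (l - 2 * j))"

definition harm_const :: "nat \<Rightarrow> nat \<Rightarrow> real" where
  "harm_const n l = sqrt (fact (n - 3) * fact l * (real n + 2 * real l - 2) /
                          (fact (n + l - 3) * (real n - 2)))"

text \<open>p_l^{(k)}(x) = A C_l^{(n-2)/2}(x_k); coordinates are indexed 0..n-1.\<close>
definition zonal :: "nat \<Rightarrow> nat \<Rightarrow> nat \<Rightarrow> (nat \<Rightarrow> real) \<Rightarrow> real" where
  "zonal n l k x = harm_const n l * gegenbauer ((real n - 2) / 2) l (x k)"

definition harm_sum :: "nat \<Rightarrow> nat \<Rightarrow> (nat \<Rightarrow> real) \<Rightarrow> (nat \<Rightarrow> real) \<Rightarrow> real" where
  "harm_sum n l a x = (\<Sum>i<n. a i * zonal n l i x)"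

definition dTV :: "real measure \<Rightarrow> real measure \<Rightarrow> real" where
  "dTV M N = Sup {\<bar>measure M A - measure N A\<bar> | A. A \<in> sets borel}"

end

theory Submission
  imports Defs
begin

text \<open>
  Let \<open>L\<^sub>i\<^sub>k = x\<^sub>i \<partial>\<^sub>k - x\<^sub>k \<partial>\<^sub>i\<close>. Rotation invariance of \<open>X\<close> gives \<open>E[(L\<^sub>i\<^sub>k F)(X)] = 0\<close>. Write \<open>\<phi>\<close> for the
  normalised Gegenbauer polynomial, \<open>p = \<Sum> a\<^sub>k \<phi>(x\<^sub>k)\<close> and \<open>\<mu> = l(n+l-2)\<close>. Taking
  \<open>F = x\<^sub>i \<phi>'(x\<^sub>k) g(p)\<close>, summing over \<open>i \<noteq> k\<close> and using the Gegenbauer equation for \<open>\<phi>\<close> yields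
  \<open>\<mu> E[p g(p)] = E[g'(p) W]\<close> with \<open>W = \<Sum> a\<^sub>k\<^sup>2 \<phi>'(x\<^sub>k)\<^sup>2 - (\<Sum> a\<^sub>k x\<^sub>k \<phi>'(x\<^sub>k))\<^sup>2\<close>, the squared spherical
  gradient of \<open>p\<close>. With \<open>g\<close> a solution of Stein's equation, which satisfies \<open>|g'| \<le> 2\<close>, the total
  variation distance is at most \<open>2 E|1 - W/\<mu>|\<close>. The same integration by parts computes the mixed
  moments of two coordinates; they show that the values of a fixed polynomial at two rescaled
  coordinates have covariance \<open>O(1/n)\<close>. As \<open>l\<close> is odd, the functions \<open>x\<^sub>k \<phi>'(x\<^sub>k)\<close> are pairwise
  uncorrelated. Together with \<open>\<Sum> a\<^sub>i\<^sup>4 \<ge> 1/n\<close> this bounds \<open>E|1 - W/\<mu>|\<close> by a multiple of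
  \<open>(\<Sum> a\<^sub>i\<^sup>4)\<^sup>1\<^sup>/\<^sup>2\<close>. For random \<open>a\<close>, measurability of the distance follows because the supremum may
  be restricted to a countable family of open sets.
\<close>

subsection \<open>Rotation invariance of the uniform measure on the sphere\<close>

text \<open>Oddness of \<open>l\<close> is essential: for \<open>l = 2\<close> and equal
  \<open>a_i\<close> the function \<open>p\<close> vanishes on the whole sphere. For odd
  \<open>l\<close> distinct zonal terms are orthogonal, so p has variance 1 and
  \<open>W / \<mu>\<close> has mean 1 (take \<open>g y = y\<close>), which is why it is compared
  with 1. All bounds must be uniform in \<open>n\<close>. Polynomials are therefore measured only by
  their coefficients, with a factor \<open>sqrt n\<close> allowed per degree; the decay of the
  coordinate moments cancels exactly this growth. The fields \<open>L_ik\<close> are tangent to the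
  sphere, so neither a Laplacian nor a surface integral has to be set up. Their one input is
  invariance under plane rotations, which comes from translation invariance of Lebesgue measure
  because a rotation is a product of three shears. Stein's equation is solved for continuous test
  functions only, so that its solution is continuously differentiable along rotations; regularity of
  Borel measures on the line recovers all Borel sets.\<close>

lemma lebesgue_Rn_simps [simp]:
  "space (lebesgue_Rn n) = PiE {..<n} (\<lambda>_. UNIV)"
  "sets (lebesgue_Rn n) = sets (PiM {..<n} (\<lambda>_. borel))"
  by (auto simp: lebesgue_Rn_def space_PiM intro!: sets_PiM_cong)

lemma measurable_lebesgue_Rn [simp]:
  "measurable (lebesgue_Rn n) M = measurable (PiM {..<n} (\<lambda>_. borel)) M"
  "measurable M (lebesgue_Rn n) = measurable M (PiM {..<n} (\<lambda>_. borel))"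
  by (rule measurable_cong_sets; simp)+

definition shear :: "nat \<Rightarrow> nat \<Rightarrow> real \<Rightarrow> (nat \<Rightarrow> real) \<Rightarrow> nat \<Rightarrow> real" where
  "shear i k t x = x(i := x i + t * x k)"

lemma measurable_shear [measurable]:
  assumes "i < n" "k < n"
  shows "shear i k t \<in> measurable (PiM {..<n} (\<lambda>_. borel)) (PiM {..<n} (\<lambda>_. borel))"
proof -
  have "(\<lambda>x. x(i := x i + t * x k)) \<in> measurable (PiM {..<n} (\<lambda>_. borel)) (PiM {..<n} (\<lambda>_. borel))"
    by (rule measurable_fun_upd[where J="{..<n}" and f="\<lambda>x. x"])
       (use assms in \<open>auto intro!: borel_measurable_add borel_measurable_times\<close>)
  thus ?thesis unfolding shear_def .
qed

text \<open>With the other coordinates fixed, a shear translates coordinate \<open>i\<close> by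
  \<open>t * x k\<close>, and \<open>k \<noteq> i\<close> makes this amount constant along the line.
  Fubini in that coordinate and translation invariance of \<open>lborel\<close> finish.\<close>

lemma distr_shear:
  assumes "i < n" "k < n" "i \<noteq> k"
  shows "distr (lebesgue_Rn n) (lebesgue_Rn n) (shear i k t) = lebesgue_Rn n"
proof (rule measure_eqI)
  fix A assume "A \<in> sets (distr (lebesgue_Rn n) (lebesgue_Rn n) (shear i k t))"
  hence A [measurable]: "A \<in> sets (PiM {..<n} (\<lambda>_. borel))" by simp
  interpret product_sigma_finite "\<lambda>_. lborel :: real measure" by unfold_locales
  define I where "I = {..<n} - {i}"
  have I: "{..<n} = insert i I" "finite I" "i \<notin> I" "k \<in> I" using assms by (auto simp: I_def)
  have sets: "sets (PiM {..<n} (\<lambda>_. lborel :: real measure)) = sets (PiM {..<n} (\<lambda>_. borel))"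
    by (rule sets_PiM_cong) auto
  have nn: "(\<integral>\<^sup>+x. f x \<partial>lebesgue_Rn n) = (\<integral>\<^sup>+x. \<integral>\<^sup>+y. f (x(i := y)) \<partial>lborel \<partial>PiM I (\<lambda>_. lborel))"
    if f: "f \<in> borel_measurable (PiM {..<n} (\<lambda>_. borel))" for f
    unfolding lebesgue_Rn_def I(1)
    by (rule product_nn_integral_insert[OF I(2,3)])
       (use f in \<open>simp add: I(1)[symmetric] cong: measurable_cong_sets[OF sets refl]\<close>)
  have upd: "(\<lambda>y. x(i := y)) \<in> measurable borel (PiM {..<n} (\<lambda>_. borel))"
    if "x \<in> space (PiM I (\<lambda>_. lborel))" for x
    by (rule measurable_fun_upd[where J=I]) (use that I in \<open>auto simp: space_PiM\<close>)
  have "emeasure (distr (lebesgue_Rn n) (lebesgue_Rn n) (shear i k t)) A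
      = (\<integral>\<^sup>+x. indicator A (shear i k t x) \<partial>lebesgue_Rn n)"
    using assms by (subst nn_integral_indicator[symmetric], simp, subst nn_integral_distr) auto
  also have "\<dots> = (\<integral>\<^sup>+x. \<integral>\<^sup>+y. indicator A (shear i k t (x(i := y))) \<partial>lborel \<partial>PiM I (\<lambda>_. lborel))"
    by (rule nn) (use assms in measurable)
  also have "\<dots> = (\<integral>\<^sup>+x. \<integral>\<^sup>+y. indicator A (x(i := y)) \<partial>lborel \<partial>PiM I (\<lambda>_. lborel))"
  proof (rule nn_integral_cong)
    fix x assume x: "x \<in> space (PiM I (\<lambda>_. lborel :: real measure))"
    note [measurable] = upd[OF x]
    have "(\<integral>\<^sup>+y. indicator A (x(i := y)) \<partial>lborel) = (\<integral>\<^sup>+y. indicator A (x(i := y)) \<partial>distr lborel borel (\<lambda>y. t * x k + y))"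
      by (simp add: lborel_distr_plus)
    also have "\<dots> = (\<integral>\<^sup>+y. indicator A (x(i := t * x k + y)) \<partial>lborel)"
      by (subst nn_integral_distr) auto
    also have "\<dots> = (\<integral>\<^sup>+y. indicator A (shear i k t (x(i := y))) \<partial>lborel)"
      using assms by (simp add: shear_def add.commute)
    finally show "(\<integral>\<^sup>+y. indicator A (shear i k t (x(i := y))) \<partial>lborel) = (\<integral>\<^sup>+y. indicator A (x(i := y)) \<partial>lborel)"
      by simp
  qed
  also have "\<dots> = (\<integral>\<^sup>+x. indicator A x \<partial>lebesgue_Rn n)"
    by (rule nn[symmetric]) measurable
  finally show "emeasure (distr (lebesgue_Rn n) (lebesgue_Rn n) (shear i k t)) A = emeasure (lebesgue_Rn n) A"
    by simp
qed simp

definition rot :: "nat \<Rightarrow> nat \<Rightarrow> real \<Rightarrow> (nat \<Rightarrow> real) \<Rightarrow> nat \<Rightarrow> real" where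
  "rot i k \<theta> x = x(i := cos \<theta> * x i - sin \<theta> * x k, k := sin \<theta> * x i + cos \<theta> * x k)"

text \<open>The classical factorisation of a plane rotation;
  \<open>(cos \<theta> - 1) / sin \<theta>\<close> is \<open>- tan (\<theta> / 2)\<close>. It
  reduces rotation invariance to shear invariance. Angles with \<open>sin \<theta> = 0\<close> are
  excluded by the division, and only small positive angles are used later.\<close>

lemma rot_eq_shears:
  assumes "sin \<theta> \<noteq> 0" "i \<noteq> k"
  shows "rot i k \<theta> = shear i k ((cos \<theta> - 1) / sin \<theta>) \<circ> shear k i (sin \<theta>) \<circ> shear i k ((cos \<theta> - 1) / sin \<theta>)"
proof (intro ext)
  fix x :: "nat \<Rightarrow> real" and j
  define u where "u = (cos \<theta> - 1) / sin \<theta>"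
  have u: "u * sin \<theta> = cos \<theta> - 1" using assms by (simp add: u_def)
  have "u * (1 + cos \<theta>) * sin \<theta> = (cos \<theta> - 1) * (1 + cos \<theta>)"
    by (simp add: u[symmetric])
  also have "\<dots> = (cos \<theta>)\<^sup>2 - 1" by (simp add: algebra_simps power2_eq_square)
  also have "\<dots> = - sin \<theta> * sin \<theta>" using sin_cos_squared_add[of \<theta>] by (simp add: power2_eq_square)
  finally have "u * (1 + cos \<theta>) * sin \<theta> = - sin \<theta> * sin \<theta>" .
  hence v: "u * (1 + cos \<theta>) = - sin \<theta>" using assms(1) mult_right_cancel by blast
  have "sin \<theta> * (x i + u * x k) + x k = sin \<theta> * x i + (1 + u * sin \<theta>) * x k"
    by (simp add: algebra_simps)
  hence 1: "sin \<theta> * (x i + u * x k) + x k = sin \<theta> * x i + cos \<theta> * x k" by (simp add: u)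
  have "x i + u * x k + u * (sin \<theta> * x i + cos \<theta> * x k) = (1 + u * sin \<theta>) * x i + u * (1 + cos \<theta>) * x k"
    by (simp add: algebra_simps)
  also have "\<dots> = cos \<theta> * x i - sin \<theta> * x k" by (simp add: u v)
  finally show "rot i k \<theta> x j = (shear i k ((cos \<theta> - 1) / sin \<theta>) \<circ> shear k i (sin \<theta>) \<circ> shear i k ((cos \<theta> - 1) / sin \<theta>)) x j"
    using assms 1 by (auto simp: rot_def shear_def u_def[symmetric] add.commute)
qed

lemma measurable_rot:
  assumes "i < n" "k < n" "i \<noteq> k" "sin \<theta> \<noteq> 0"
  shows "rot i k \<theta> \<in> measurable (PiM {..<n} (\<lambda>_. borel)) (PiM {..<n} (\<lambda>_. borel))"
  unfolding rot_eq_shears[OF assms(4,3)] using assms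
  by (auto intro!: measurable_comp[where N="PiM {..<n} (\<lambda>_. borel)"] measurable_shear)

lemma distr_rot:
  assumes "i < n" "k < n" "i \<noteq> k" "sin \<theta> \<noteq> 0"
  shows "distr (lebesgue_Rn n) (lebesgue_Rn n) (rot i k \<theta>) = lebesgue_Rn n"
proof -
  let ?u = "(cos \<theta> - 1) / sin \<theta>"
  have "distr (lebesgue_Rn n) (lebesgue_Rn n) (rot i k \<theta>) =
    distr (distr (distr (lebesgue_Rn n) (lebesgue_Rn n) (shear i k ?u)) (lebesgue_Rn n) (shear k i (sin \<theta>)))
      (lebesgue_Rn n) (shear i k ?u)"
    unfolding rot_eq_shears[OF assms(4,3)] using assms
    by (simp add: distr_distr measurable_shear measurable_comp[OF measurable_shear measurable_shear] comp_assoc)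
  thus ?thesis using assms by (simp add: distr_shear)
qed

lemma sum_squares_rot:
  assumes "i < n" "k < n" "i \<noteq> k"
  shows "(\<Sum>j<n. (rot i k \<theta> x j)\<^sup>2) = (\<Sum>j<n. (x j)\<^sup>2)"
proof -
  have I: "{..<n} = insert i (insert k ({..<n} - {i,k}))" using assms by auto
  have "(cos \<theta> * x i - sin \<theta> * x k)\<^sup>2 + (sin \<theta> * x i + cos \<theta> * x k)\<^sup>2
     = ((sin \<theta>)\<^sup>2 + (cos \<theta>)\<^sup>2) * ((x i)\<^sup>2 + (x k)\<^sup>2)"
    by algebra
  hence "(cos \<theta> * x i - sin \<theta> * x k)\<^sup>2 + (sin \<theta> * x i + cos \<theta> * x k)\<^sup>2 = (x i)\<^sup>2 + (x k)\<^sup>2"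
    by simp
  moreover have "(\<Sum>j\<in>{..<n} - {i,k}. (rot i k \<theta> x j)\<^sup>2) = (\<Sum>j\<in>{..<n} - {i,k}. (x j)\<^sup>2)"
    by (rule sum.cong) (auto simp: rot_def)
  ultimately show ?thesis
    using assms by (subst (1 2) I) (simp add: rot_def)
qed

lemma eucl_norm_rot:
  assumes "i < n" "k < n" "i \<noteq> k"
  shows "eucl_norm n (rot i k \<theta> x) = eucl_norm n x"
  using sum_squares_rot[OF assms] by (simp add: eucl_norm_def)

section \<open>The unit ball and its radial projection\<close>

lemma borel_measurable_eucl_norm [measurable]: "eucl_norm n \<in> borel_measurable (PiM {..<n} (\<lambda>_. borel))"
  unfolding eucl_norm_def by measurable

lemma sets_unit_ball [measurable]: "unit_ball n \<in> sets (PiM {..<n} (\<lambda>_. borel))"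
proof -
  have "unit_ball n = {x \<in> space (PiM {..<n} (\<lambda>_. borel)). eucl_norm n x \<le> 1}"
    by (simp add: unit_ball_def space_PiM)
  thus ?thesis by simp
qed

lemma emeasure_lebesgue_Rn_box:
  assumes "a \<le> b"
  shows "emeasure (lebesgue_Rn n) (PiE {..<n} (\<lambda>_. {a..b})) = ennreal ((b - a) ^ n)"
proof -
  interpret product_sigma_finite "\<lambda>_. lborel :: real measure" by unfold_locales
  show ?thesis using assms unfolding lebesgue_Rn_def
    by (subst emeasure_PiM) (auto simp: prod_ennreal ennreal_power)
qed

text \<open>The ball contains the cube with sides \<open>{0..1 / n}\<close> and lies in the cube
  with sides \<open>{-1..1}\<close>. Positive and finite volume make its normalised measure a
  probability measure.\<close>

lemma emeasure_unit_ball: "n > 0 \<Longrightarrow> emeasure (lebesgue_Rn n) (unit_ball n) \<noteq> 0"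
  "emeasure (lebesgue_Rn n) (unit_ball n) \<noteq> \<infinity>"
proof -
  have "unit_ball n \<subseteq> PiE {..<n} (\<lambda>_. {-1..1})"
  proof
    fix x assume x: "x \<in> unit_ball n"
    hence 1: "(\<Sum>i<n. (x i)\<^sup>2) \<le> 1" by (simp add: unit_ball_def eucl_norm_def)
    have "x i \<in> {-1..1}" if "i < n" for i
    proof -
      have "(x i)\<^sup>2 \<le> (\<Sum>i<n. (x i)\<^sup>2)" using that by (intro member_le_sum) auto
      thus ?thesis using 1 abs_le_square_iff[of "x i" 1] by auto
    qed
    thus "x \<in> PiE {..<n} (\<lambda>_. {-1..1})" using x by (auto simp: unit_ball_def PiE_iff)
  qed
  hence "emeasure (lebesgue_Rn n) (unit_ball n) \<le> emeasure (lebesgue_Rn n) (PiE {..<n} (\<lambda>_. {-1..1}))"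
    by (intro emeasure_mono) (auto intro!: sets_PiM_I_finite)
  thus "emeasure (lebesgue_Rn n) (unit_ball n) \<noteq> \<infinity>"
    by (auto simp: emeasure_lebesgue_Rn_box top_unique)
next
  assume n: "n > 0"
  have "PiE {..<n} (\<lambda>_. {0..1 / real n}) \<subseteq> unit_ball n"
  proof
    fix x :: "nat \<Rightarrow> real" assume x: "x \<in> PiE {..<n} (\<lambda>_. {0..1 / real n})"
    have "(\<Sum>i<n. (x i)\<^sup>2) \<le> (\<Sum>i<n. 1 / real n)"
    proof (rule sum_mono)
      fix i assume "i \<in> {..<n}"
      hence i: "0 \<le> x i" "x i \<le> 1 / n" using x by (auto simp: PiE_iff)
      have "(x i)\<^sup>2 \<le> (1 / n) * 1"
        unfolding power2_eq_square
        by (rule mult_mono) (use i n in \<open>auto intro!: order_trans[OF i(2)] simp: field_simps\<close>)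
      thus "(x i)\<^sup>2 \<le> 1 / n" by simp
    qed
    thus "x \<in> unit_ball n" using n x by (auto simp: unit_ball_def eucl_norm_def PiE_iff)
  qed
  hence "emeasure (lebesgue_Rn n) (PiE {..<n} (\<lambda>_. {0..1 / real n})) \<le> emeasure (lebesgue_Rn n) (unit_ball n)"
    by (intro emeasure_mono) auto
  thus "emeasure (lebesgue_Rn n) (unit_ball n) \<noteq> 0"
    using n by (auto simp: emeasure_lebesgue_Rn_box)
qed

lemma sphere_unif_simps [simp]:
  "space (sphere_unif n) = PiE {..<n} (\<lambda>_. UNIV)"
  "sets (sphere_unif n) = sets (PiM {..<n} (\<lambda>_. borel))"
  by (auto simp: sphere_unif_def)

lemma measurable_sphere_unif [simp]:
  "measurable (sphere_unif n) M = measurable (PiM {..<n} (\<lambda>_. borel)) M"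
  "measurable M (sphere_unif n) = measurable M (PiM {..<n} (\<lambda>_. borel))"
  by (rule measurable_cong_sets; simp)+

lemma measurable_radial_proj [measurable]:
  "(\<lambda>x. \<lambda>i\<in>{..<n}. x i / eucl_norm n x) \<in> measurable (PiM {..<n} (\<lambda>_. borel)) (PiM {..<n} (\<lambda>_. borel))"
  by measurable

lemma prob_space_sphere_unif:
  assumes "n > 0" shows "prob_space (sphere_unif n)"
proof -
  interpret prob_space "uniform_measure (lebesgue_Rn n) (unit_ball n)"
    by (rule prob_space_uniform_measure) (use emeasure_unit_ball assms in auto)
  show ?thesis unfolding sphere_unif_def
    by (rule prob_space_distr) (simp cong: measurable_cong_sets)
qed

text \<open>A rotation preserves \<open>eucl_norm\<close>, so it maps the ball to itself and
  commutes with the radial projection. Invariance of Lebesgue measure therefore passes to the image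
  measure.\<close>

lemma distr_rot_sphere_unif:
  assumes "i < n" "k < n" "i \<noteq> k" "sin \<theta> \<noteq> 0"
  shows "distr (sphere_unif n) (sphere_unif n) (rot i k \<theta>) = sphere_unif n"
proof -
  define L where "L = lebesgue_Rn n"
  define U where "U = uniform_measure L (unit_ball n)"
  define pr where "pr = (\<lambda>x. \<lambda>i\<in>{..<n}. x i / eucl_norm n x)"
  have U[simp]: "sets U = sets (PiM {..<n} (\<lambda>_. borel))" "space U = PiE {..<n} (\<lambda>_. UNIV)"
    by (auto simp: U_def L_def)
  have Um[simp]: "measurable U M = measurable (PiM {..<n} (\<lambda>_. borel)) M" for M
    by (rule measurable_cong_sets) auto
  have [measurable]: "pr \<in> measurable (PiM {..<n} (\<lambda>_. borel)) (PiM {..<n} (\<lambda>_. borel))"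
    unfolding pr_def by measurable
  note [measurable] = measurable_rot[OF assms]
  have S: "sphere_unif n = distr U L pr" by (simp add: sphere_unif_def U_def L_def pr_def)
  have rotU: "distr U L (rot i k \<theta>) = U"
  proof (rule measure_eqI)
    fix A assume "A \<in> sets (distr U L (rot i k \<theta>))"
    hence A[measurable]: "A \<in> sets (PiM {..<n} (\<lambda>_. borel))" by (simp add: L_def)
    let ?V = "rot i k \<theta> -` A \<inter> space (PiM {..<n} (\<lambda>_. borel :: real measure))"
    have V: "?V \<in> sets (PiM {..<n} (\<lambda>_. borel))" by measurable
    have rs: "rot i k \<theta> x \<in> PiE {..<n} (\<lambda>_. UNIV) \<longleftrightarrow> x \<in> PiE {..<n} (\<lambda>_. UNIV)" for x
      using assms by (auto simp: rot_def PiE_iff extensional_def)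
    have "unit_ball n \<inter> ?V = rot i k \<theta> -` (unit_ball n \<inter> A) \<inter> space L"
      using assms by (auto simp: unit_ball_def eucl_norm_rot rs space_PiM L_def)
    hence "emeasure L (unit_ball n \<inter> ?V) = emeasure (distr L L (rot i k \<theta>)) (unit_ball n \<inter> A)"
      by (subst emeasure_distr) (auto simp: L_def)
    also have "\<dots> = emeasure L (unit_ball n \<inter> A)"
      using distr_rot[OF assms] by (simp add: L_def)
    finally have "emeasure U ?V = emeasure U A"
      unfolding U_def using V by (simp add: L_def emeasure_uniform_measure)
    thus "emeasure (distr U L (rot i k \<theta>)) A = emeasure U A"
      by (subst emeasure_distr) (auto simp: L_def space_PiM)
  qed (simp add: L_def)
  have comm: "rot i k \<theta> (pr x) = pr (rot i k \<theta> x)" for x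
  proof (intro ext)
    fix j
    have "eucl_norm n (rot i k \<theta> x) = eucl_norm n x" using assms by (intro eucl_norm_rot)
    thus "rot i k \<theta> (pr x) j = pr (rot i k \<theta> x) j" unfolding pr_def
      using assms by (auto simp: rot_def diff_divide_distrib add_divide_distrib)
  qed
  have "distr (sphere_unif n) (sphere_unif n) (rot i k \<theta>) = distr (sphere_unif n) L (rot i k \<theta>)"
    by (rule distr_cong) (auto simp: L_def)
  also have "\<dots> = distr U L (rot i k \<theta> \<circ> pr)"
    unfolding S by (subst distr_distr) (auto simp: L_def)
  also have "\<dots> = distr U L (pr \<circ> rot i k \<theta>)" by (simp add: comp_def comm)
  also have "\<dots> = distr (distr U L (rot i k \<theta>)) L pr"
    by (subst distr_distr) (auto simp: L_def)
  finally show ?thesis by (simp add: rotU S)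
qed

text \<open>The projection misses the sphere only at the origin, where division by zero returns 0.
  The hyperplane \<open>x 0 = 0\<close> contains this point and is visibly null, being a product
  set.\<close>

lemma AE_sphere_unif:
  assumes "n > 0"
  shows "AE x in sphere_unif n. (\<Sum>i<n. (x i)\<^sup>2) = 1"
proof -
  let ?L = "lebesgue_Rn n"
  let ?N = "{x \<in> space ?L. x 0 = 0}"
  have N0: "?N = PiE {..<n} (\<lambda>i. if i = 0 then {0} else UNIV)"
  proof (rule set_eqI)
    fix x :: "nat \<Rightarrow> real"
    have "x \<in> PiE {..<n} (\<lambda>i. if i = 0 then {0} else UNIV) \<longleftrightarrow>
      (\<forall>i<n. i = 0 \<longrightarrow> x i = 0) \<and> x \<in> extensional {..<n}"
      unfolding PiE_iff by simp
    thus "x \<in> ?N \<longleftrightarrow> x \<in> PiE {..<n} (\<lambda>i. if i = 0 then {0} else UNIV)"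
      using assms by (simp add: PiE_iff conj_commute)
  qed
  interpret product_sigma_finite "\<lambda>_. lborel :: real measure" by unfold_locales
  have "emeasure ?L ?N = (\<Prod>i<n. emeasure lborel (if i = 0 then {0::real} else UNIV))"
    by (subst N0, unfold lebesgue_Rn_def, rule emeasure_PiM) auto
  also have "\<dots> = 0" using assms by (auto intro!: bexI[of _ 0])
  finally have "AE x in ?L. x 0 \<noteq> 0"
    by (intro AE_I[where N="?N"]) (use assms in \<open>auto simp: N0 simp del: lebesgue_Rn_simps(1) intro!: sets_PiM_I_finite\<close>)
  hence ae: "AE x in uniform_measure ?L (unit_ball n). x 0 \<noteq> 0"
    by (intro AE_uniform_measureI) (simp, auto)
  show ?thesis unfolding sphere_unif_def
  proof (subst AE_distr_iff)
    show "AE x in uniform_measure ?L (unit_ball n). (\<Sum>i<n. ((\<lambda>i\<in>{..<n}. x i / eucl_norm n x) i)\<^sup>2) = 1"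
      using ae
    proof eventually_elim
      case (elim x)
      have "(x 0)\<^sup>2 \<le> (\<Sum>i<n. (x i)\<^sup>2)" using assms by (intro member_le_sum) auto
      hence p: "(\<Sum>i<n. (x i)\<^sup>2) > 0" using elim by (smt (verit) zero_less_power2)
      have "(\<Sum>i<n. ((\<lambda>i\<in>{..<n}. x i / eucl_norm n x) i)\<^sup>2) = (\<Sum>i<n. (x i)\<^sup>2 / (eucl_norm n x)\<^sup>2)"
        by (rule sum.cong) (auto simp: power_divide)
      also have "\<dots> = 1" using p by (simp add: sum_divide_distrib[symmetric] eucl_norm_def)
      finally show ?case .
    qed
  qed (auto simp: cong: measurable_cong_sets)
qed

subsection \<open>Integration by parts along rotation fields\<close>

text \<open>Coordinates are unbounded on the whole product space, so a bound is asked for only on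
  the unit sphere, which carries the measure. The class is closed under all operations used below,
  which reduces every integrability claim to syntax.\<close>

definition sphere_bounded :: "nat \<Rightarrow> ((nat \<Rightarrow> real) \<Rightarrow> real) \<Rightarrow> bool" where
  "sphere_bounded n F \<longleftrightarrow> F \<in> borel_measurable (PiM {..<n} (\<lambda>_. borel)) \<and>
     (\<exists>K. \<forall>x. (\<Sum>i<n. (x i)\<^sup>2) = 1 \<longrightarrow> \<bar>F x\<bar> \<le> K)"

lemma sphere_boundedE:
  assumes "sphere_bounded n F"
  obtains K where "\<And>x. (\<Sum>i<n. (x i)\<^sup>2) = 1 \<Longrightarrow> \<bar>F x\<bar> \<le> K"
  using assms unfolding sphere_bounded_def by blast

lemma sphere_bounded_measurable:
  "sphere_bounded n F \<Longrightarrow> F \<in> borel_measurable (PiM {..<n} (\<lambda>_. borel))"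
  by (simp add: sphere_bounded_def)

lemma sphere_coord_le:
  fixes x :: "nat \<Rightarrow> real"
  assumes "(\<Sum>i<n. (x i)\<^sup>2) = 1" "j < n" shows "\<bar>x j\<bar> \<le> 1"
proof -
  have "(x j)\<^sup>2 \<le> (\<Sum>i<n. (x i)\<^sup>2)" using assms by (intro member_le_sum) auto
  thus ?thesis using assms abs_le_square_iff[of "x j" 1] by auto
qed

lemma sphere_bounded_const: "sphere_bounded n (\<lambda>x. c)"
  unfolding sphere_bounded_def by auto

lemma sphere_bounded_coord: "j < n \<Longrightarrow> sphere_bounded n (\<lambda>x. x j)"
  unfolding sphere_bounded_def using sphere_coord_le by auto

lemma sphere_bounded_add:
  assumes "sphere_bounded n F" "sphere_bounded n G" shows "sphere_bounded n (\<lambda>x. F x + G x)"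
proof -
  obtain K L where "\<And>x. (\<Sum>i<n. (x i)\<^sup>2) = 1 \<Longrightarrow> \<bar>F x\<bar> \<le> K" "\<And>x. (\<Sum>i<n. (x i)\<^sup>2) = 1 \<Longrightarrow> \<bar>G x\<bar> \<le> L"
    using assms sphere_boundedE by metis
  hence "\<And>x. (\<Sum>i<n. (x i)\<^sup>2) = 1 \<Longrightarrow> \<bar>F x + G x\<bar> \<le> K + L"
    by (smt (verit, best) abs_triangle_ineq)
  thus ?thesis using assms unfolding sphere_bounded_def by (auto intro!: borel_measurable_add)
qed

lemma sphere_bounded_mult:
  assumes "sphere_bounded n F" "sphere_bounded n G" shows "sphere_bounded n (\<lambda>x. F x * G x)"
proof -
  obtain K L where K: "\<And>x. (\<Sum>i<n. (x i)\<^sup>2) = 1 \<Longrightarrow> \<bar>F x\<bar> \<le> K" "\<And>x. (\<Sum>i<n. (x i)\<^sup>2) = 1 \<Longrightarrow> \<bar>G x\<bar> \<le> L"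
    using assms sphere_boundedE by metis
  have "\<bar>F x * G x\<bar> \<le> K * L" if "(\<Sum>i<n. (x i)\<^sup>2) = 1" for x
    using K[OF that] by (simp add: abs_mult mult_mono')
  thus ?thesis using assms unfolding sphere_bounded_def by (auto intro!: borel_measurable_times)
qed

lemma sphere_bounded_uminus: "sphere_bounded n F \<Longrightarrow> sphere_bounded n (\<lambda>x. - F x)"
  using sphere_bounded_mult[OF sphere_bounded_const[of n "-1"]] by simp

lemma sphere_bounded_diff:
  "sphere_bounded n F \<Longrightarrow> sphere_bounded n G \<Longrightarrow> sphere_bounded n (\<lambda>x. F x - G x)"
  using sphere_bounded_add[OF _ sphere_bounded_uminus, of n F G] by simp

lemma sphere_bounded_divide: "sphere_bounded n F \<Longrightarrow> sphere_bounded n (\<lambda>x. F x / c)"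
  using sphere_bounded_mult[OF _ sphere_bounded_const, of n F "1 / c"] by simp

lemma sphere_bounded_power: "sphere_bounded n F \<Longrightarrow> sphere_bounded n (\<lambda>x. F x ^ m)"
  by (induction m) (auto intro: sphere_bounded_const sphere_bounded_mult)

lemma sphere_bounded_sum:
  "(\<And>i. i \<in> I \<Longrightarrow> sphere_bounded n (F i)) \<Longrightarrow> sphere_bounded n (\<lambda>x. \<Sum>i\<in>I. F i x)"
  by (induction I rule: infinite_finite_induct) (auto intro: sphere_bounded_const sphere_bounded_add)

lemma sphere_bounded_continuous:
  fixes g :: "real \<Rightarrow> real"
  assumes g: "continuous_on UNIV g" and F: "sphere_bounded n F"
  shows "sphere_bounded n (\<lambda>x. g (F x))"
proof -
  obtain K where K: "\<And>x. (\<Sum>i<n. (x i)\<^sup>2) = 1 \<Longrightarrow> \<bar>F x\<bar> \<le> K" using F sphere_boundedE by metis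
  have "compact (g ` {-K..K})"
    by (intro compact_continuous_image continuous_on_subset[OF g]) auto
  then obtain B where B: "\<And>y. y \<in> {-K..K} \<Longrightarrow> \<bar>g y\<bar> \<le> B"
    using compact_imp_bounded[of "g ` {-K..K}"] unfolding bounded_iff by fastforce
  have "\<bar>g (F x)\<bar> \<le> B" if "(\<Sum>i<n. (x i)\<^sup>2) = 1" for x
    using K[OF that] by (intro B) auto
  moreover have "(\<lambda>x. g (F x)) \<in> borel_measurable (PiM {..<n} (\<lambda>_. borel))"
    using borel_measurable_continuous_onI[OF g] sphere_bounded_measurable[OF F] by measurable
  ultimately show ?thesis unfolding sphere_bounded_def by blast
qed

lemma continuous_on_poly_UNIV: "continuous_on UNIV (poly (p :: real poly))"
  by (intro continuous_at_imp_continuous_on ballI poly_isCont)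

lemma sphere_bounded_abs: "sphere_bounded n F \<Longrightarrow> sphere_bounded n (\<lambda>x. \<bar>F x\<bar>)"
  by (rule sphere_bounded_continuous[of abs]) (auto intro: continuous_intros)

lemma sphere_bounded_poly: "sphere_bounded n F \<Longrightarrow> sphere_bounded n (\<lambda>x. poly p (F x))"
  by (rule sphere_bounded_continuous[OF continuous_on_poly_UNIV])

lemmas sphere_bounded_intros = sphere_bounded_const sphere_bounded_coord sphere_bounded_add
  sphere_bounded_mult sphere_bounded_uminus sphere_bounded_diff sphere_bounded_divide sphere_bounded_power
  sphere_bounded_sum sphere_bounded_poly sphere_bounded_abs

lemma integrable_sphere_bounded:
  assumes "n > 0" "sphere_bounded n F" shows "integrable (sphere_unif n) F"
proof -
  interpret prob_space "sphere_unif n" by (rule prob_space_sphere_unif[OF assms(1)])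
  obtain K where "\<And>x. (\<Sum>i<n. (x i)\<^sup>2) = 1 \<Longrightarrow> \<bar>F x\<bar> \<le> K" using assms sphere_boundedE by metis
  thus ?thesis using AE_sphere_unif[OF assms(1)] sphere_bounded_measurable[OF assms(2)]
    by (intro integrable_const_bound[where B=K]) auto
qed

lemma integral_sphere_cong:
  assumes "n > 0" "sphere_bounded n F" "sphere_bounded n G"
    "\<And>x. (\<Sum>i<n. (x i)\<^sup>2) = 1 \<Longrightarrow> F x = G x"
  shows "(\<integral>x. F x \<partial>sphere_unif n) = (\<integral>x. G x \<partial>sphere_unif n)"
proof (rule integral_cong_AE)
  show "AE x in sphere_unif n. F x = G x"
    using AE_sphere_unif[OF assms(1)] by eventually_elim (rule assms(4))
qed (use assms(2,3) sphere_bounded_measurable in auto)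

text \<open>\<^term>\<open>D\<close> is the image of \<^term>\<open>F\<close> under the rotation field
  \<open>x\<^sub>i \<partial>\<^sub>k - x\<^sub>k \<partial>\<^sub>i\<close>; it is tested along arbitrary curves whose velocity is that field.\<close>

definition rot_deriv :: "nat \<Rightarrow> nat \<Rightarrow> ((nat \<Rightarrow> real) \<Rightarrow> real) \<Rightarrow> ((nat \<Rightarrow> real) \<Rightarrow> real) \<Rightarrow> bool" where
  "rot_deriv i k F D \<longleftrightarrow> (\<forall>u \<theta>.
     (\<forall>j. ((\<lambda>\<theta>. u \<theta> j) has_real_derivative (if j = i then - u \<theta> k else if j = k then u \<theta> i else 0)) (at \<theta>))
     \<longrightarrow> ((\<lambda>\<theta>. F (u \<theta>)) has_real_derivative D (u \<theta>)) (at \<theta>))"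

lemma rot_derivI:
  assumes "\<And>u \<theta>. (\<And>j. ((\<lambda>\<theta>. u \<theta> j) has_real_derivative
      (if j = i then - u \<theta> k else if j = k then u \<theta> i else 0)) (at \<theta>)) \<Longrightarrow>
      ((\<lambda>\<theta>. F (u \<theta>)) has_real_derivative D (u \<theta>)) (at \<theta>)"
  shows "rot_deriv i k F D"
  unfolding rot_deriv_def using assms by auto

lemma rot_derivD:
  assumes "rot_deriv i k F D" "\<And>j. ((\<lambda>\<theta>. u \<theta> j) has_real_derivative
      (if j = i then - u \<theta> k else if j = k then u \<theta> i else 0)) (at \<theta>)"
  shows "((\<lambda>\<theta>. F (u \<theta>)) has_real_derivative D (u \<theta>)) (at \<theta>)"
  using assms unfolding rot_deriv_def by auto

lemma rot_deriv_coord: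
  "rot_deriv i k (\<lambda>x. x j) (\<lambda>x. if j = i then - x k else if j = k then x i else 0)"
  unfolding rot_deriv_def by blast

lemma rot_deriv_mult:
  assumes "rot_deriv i k F D" "rot_deriv i k G E"
  shows "rot_deriv i k (\<lambda>x. F x * G x) (\<lambda>x. D x * G x + E x * F x)"
  by (intro rot_derivI DERIV_mult rot_derivD[OF assms(1)] rot_derivD[OF assms(2)])

lemma rot_deriv_cmult:
  assumes "rot_deriv i k F D" shows "rot_deriv i k (\<lambda>x. c * F x) (\<lambda>x. c * D x)"
  by (intro rot_derivI DERIV_cmult rot_derivD[OF assms])

lemma rot_deriv_sum:
  assumes "\<And>j. j \<in> I \<Longrightarrow> rot_deriv i k (F j) (D j)"
  shows "rot_deriv i k (\<lambda>x. \<Sum>j\<in>I. F j x) (\<lambda>x. \<Sum>j\<in>I. D j x)"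
  by (intro rot_derivI DERIV_sum rot_derivD[OF assms])

lemma rot_deriv_chain:
  assumes "\<And>y. (g has_real_derivative g' y) (at y)" "rot_deriv i k F D"
  shows "rot_deriv i k (\<lambda>x. g (F x)) (\<lambda>x. g' (F x) * D x)"
  by (intro rot_derivI DERIV_chain2[OF assms(1)] rot_derivD[OF assms(2)])

lemma rot_deriv_cong: "rot_deriv i k F D \<Longrightarrow> (\<And>x. D x = E x) \<Longrightarrow> rot_deriv i k F E"
  unfolding rot_deriv_def by simp

text \<open>By invariance the difference quotients of \<open>F\<close> along the rotation have
  integral 0. The mean value theorem expresses each as a value of \<open>D\<close> on the same
  orbit, which stays on the sphere, so the bound on \<open>D\<close> permits dominated convergence
  to the derivative at angle 0.\<close>

lemma integral_rot_deriv:
  assumes ik: "i < n" "k < n" "i \<noteq> k"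
    and F: "sphere_bounded n F" and D: "sphere_bounded n D" and deriv: "rot_deriv i k F D"
  shows "(\<integral>x. D x \<partial>sphere_unif n) = 0"
proof -
  let ?S = "sphere_unif n"
  have n: "n > 0" using ik by simp
  interpret prob_space ?S by (rule prob_space_sphere_unif[OF n])
  \<comment> \<open>These angles lie in \<open>(0, 1]\<close>, where the sine is positive, so the
    rotations are among those known to preserve the measure.\<close>
  define t where "t m = 1 / (real m + 1)" for m :: nat
  have t0: "t m > 0" "t m \<le> 1" for m by (auto simp: t_def)
  have sin0: "sin (t m) \<noteq> 0" for m
    using sin_gt_zero[of "t m"] t0[of m] pi_gt3 by force
  note [measurable] = sphere_bounded_measurable[OF F] sphere_bounded_measurable[OF D]
  note [measurable] = measurable_rot[OF ik sin0]
  obtain K where K: "\<And>x. (\<Sum>i<n. (x i)\<^sup>2) = 1 \<Longrightarrow> \<bar>D x\<bar> \<le> K" using D sphere_boundedE by metis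
  have der: "((\<lambda>\<theta>. F (rot i k \<theta> x)) has_real_derivative D (rot i k \<theta> x)) (at \<theta>)" for x \<theta>
  proof -
    have "((\<lambda>\<theta>. rot i k \<theta> x j) has_real_derivative
        (if j = i then - rot i k \<theta> x k else if j = k then rot i k \<theta> x i else 0)) (at \<theta>)" for j
      using ik by (auto simp: rot_def intro!: derivative_eq_intros)
    thus ?thesis by (rule rot_derivD[OF deriv])
  qed
  have rot0: "rot i k 0 x = x" for x by (auto simp: rot_def)
  define q where "q m x = (F (rot i k (t m) x) - F x) / t m" for m x
  have q0: "(\<integral>x. q m x \<partial>?S) = 0" for m
  proof -
    have "(\<integral>x. F (rot i k (t m) x) \<partial>?S) = (\<integral>x. F x \<partial>distr ?S ?S (rot i k (t m)))"
      by (subst integral_distr) auto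
    also have "\<dots> = (\<integral>x. F x \<partial>?S)" using distr_rot_sphere_unif[OF ik sin0] by simp
    finally have eq: "(\<integral>x. F (rot i k (t m) x) \<partial>?S) = (\<integral>x. F x \<partial>?S)" .
    obtain K' where "\<And>x. (\<Sum>i<n. (x i)\<^sup>2) = 1 \<Longrightarrow> \<bar>F x\<bar> \<le> K'" using F sphere_boundedE by metis
    hence "AE x in ?S. \<bar>F (rot i k (t m) x)\<bar> \<le> K'"
      using AE_sphere_unif[OF n] by (auto simp: sum_squares_rot[OF ik])
    hence "integrable ?S (\<lambda>x. F (rot i k (t m) x))"
      by (intro integrable_const_bound[where B=K']) auto
    thus ?thesis unfolding q_def using integrable_sphere_bounded[OF n F] eq by simp
  qed
  have "(\<lambda>m. \<integral>x. q m x \<partial>?S) \<longlonglongrightarrow> (\<integral>x. D x \<partial>?S)"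
  proof (rule integral_dominated_convergence[where w="\<lambda>_. K"])
    show "AE x in ?S. (\<lambda>m. q m x) \<longlonglongrightarrow> D x"
    proof (rule AE_I2)
      fix x
      have "((\<lambda>h. (F (rot i k h x) - F x) / h) \<longlongrightarrow> D x) (at 0)"
        using der[of x 0] by (simp add: DERIV_def rot0)
      moreover have "filterlim t (at 0) sequentially"
      proof -
        have "t \<longlonglongrightarrow> 0" unfolding t_def using LIMSEQ_inverse_real_of_nat by (simp add: inverse_eq_divide add.commute)
        thus ?thesis using t0 by (auto simp: filterlim_at intro!: always_eventually) (metis less_irrefl)
      qed
      ultimately show "(\<lambda>m. q m x) \<longlonglongrightarrow> D x"
        unfolding q_def by (rule filterlim_compose)
    qed
    fix m
    show "AE x in ?S. norm (q m x) \<le> K"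
      using AE_sphere_unif[OF n]
    proof eventually_elim
      case (elim x)
      obtain z where "F (rot i k (t m) x) - F (rot i k 0 x) = (t m - 0) * D (rot i k z x)"
        using MVT2[of 0 "t m" "\<lambda>\<theta>. F (rot i k \<theta> x)" "\<lambda>\<theta>. D (rot i k \<theta> x)"] der t0 by blast
      hence "q m x = D (rot i k z x)" using t0[of m] by (simp add: q_def rot0)
      thus ?case using K elim by (simp add: sum_squares_rot[OF ik])
    qed
  qed (auto simp: q_def)
  thus ?thesis using LIMSEQ_unique[OF tendsto_const, of 0 "\<integral>x. D x \<partial>?S"] by (simp add: q0)
qed

subsection \<open>The Stein identity and coordinate moments\<close>

lemma rot_deriv_poly:
  "rot_deriv i k F D \<Longrightarrow> rot_deriv i k (\<lambda>x. poly p (F x)) (\<lambda>x. poly (pderiv p) (F x) * D x)"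
  by (rule rot_deriv_chain) (rule poly_DERIV)

lemma rot_deriv_power:
  "rot_deriv i k F D \<Longrightarrow> rot_deriv i k (\<lambda>x. F x ^ m) (\<lambda>x. (real m * F x ^ (m - 1)) * D x)"
  by (rule rot_deriv_chain) (auto intro!: derivative_eq_intros)

lemma sum_except_coord:
  fixes f :: "nat \<Rightarrow> real"
  assumes "k < n" shows "(\<Sum>i\<in>{..<n}-{k}. f i) = (\<Sum>i<n. f i) - f k"
  using assms by (subst sum.remove[of "{..<n}" k]) auto

lemma stein_identity:
  fixes n :: nat and \<phi> :: "real poly" and a :: "nat \<Rightarrow> real"
  defines "P \<equiv> \<lambda>x. \<Sum>i<n. a i * poly \<phi> (x i)"
  defines "f \<equiv> pderiv \<phi>"
  assumes n: "n > 0"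
    and ode: "\<And>t. (1 - t\<^sup>2) * poly (pderiv f) t - (real n - 1) * t * poly f t = - \<mu> * poly \<phi> t"
    and g: "\<And>y. (g has_real_derivative g' y) (at y)" and g': "continuous_on UNIV g'"
  shows "\<mu> * (\<integral>x. P x * g (P x) \<partial>sphere_unif n) =
    (\<integral>x. g' (P x) * ((\<Sum>k<n. (a k)\<^sup>2 * (poly f (x k))\<^sup>2) - (\<Sum>k<n. a k * x k * poly f (x k))\<^sup>2) \<partial>sphere_unif n)"
proof -
  let ?S = "sphere_unif n"
  have gc: "continuous_on UNIV g" using g by (meson DERIV_continuous_on DERIV_subset subset_UNIV)
  define T where "T = (\<lambda>x. \<Sum>k<n. a k * x k * poly f (x k))"
  note nice = sphere_bounded_intros sphere_bounded_continuous[OF gc] sphere_bounded_continuous[OF g']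
  have P: "sphere_bounded n P" unfolding P_def by (intro nice) auto
  have T: "sphere_bounded n T" unfolding T_def by (intro nice) auto
  \<comment> \<open>The product rule for \<open>x_i d_k - x_k d_i\<close> applied to
    \<open>x_i f(x_k) g(P)\<close>: the first summand differentiates \<open>x_i\<close>, the others
    \<open>f(x_k)\<close> and \<open>g(P)\<close>. In \<open>P\<close> only the terms with index
    \<open>i\<close> and \<open>k\<close> change.\<close>
  define D where "D i k x = - x k * (poly f (x k) * g (P x))
     + x i * (poly (pderiv f) (x k) * x i * g (P x)
      + poly f (x k) * (g' (P x) * (a k * poly f (x k) * x i - a i * poly f (x i) * x k)))" for i k and x :: "nat \<Rightarrow> real"
  have D: "sphere_bounded n (D i k)" if "i < n" "k < n" for i k
    unfolding D_def using that P by (intro nice) auto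
  have D0: "(\<integral>x. D i k x \<partial>?S) = 0" if ik: "i < n" "k < n" "i \<noteq> k" for i k
  proof (rule integral_rot_deriv[OF ik])
    show "sphere_bounded n (\<lambda>x. x i * (poly f (x k) * g (P x)))" using that P by (intro nice) auto
    have dP: "rot_deriv i k P (\<lambda>x. a k * poly f (x k) * x i - a i * poly f (x i) * x k)"
    proof -
      have "rot_deriv i k P (\<lambda>x. \<Sum>j<n. a j * (poly f (x j) * (if j = i then - x k else if j = k then x i else 0)))"
        unfolding P_def f_def by (intro rot_deriv_sum rot_deriv_cmult rot_deriv_poly rot_deriv_coord)
      moreover have "(\<Sum>j<n. a j * (poly f (x j) * (if j = i then - x k else if j = k then x i else 0)))
         = (\<Sum>j\<in>{i,k}. a j * (poly f (x j) * (if j = i then - x k else if j = k then x i else 0)))" for x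
        using ik by (intro sum.mono_neutral_right) auto
      ultimately show ?thesis using ik by (elim rot_deriv_cong) (simp add: algebra_simps)
    qed
    show "rot_deriv i k (\<lambda>x. x i * (poly f (x k) * g (P x))) (D i k)"
      by (rule rot_deriv_cong[OF rot_deriv_mult[OF rot_deriv_coord rot_deriv_mult[OF rot_deriv_poly[OF rot_deriv_coord] rot_deriv_chain[OF g dP]]]])
         (use ik in \<open>auto simp: D_def algebra_simps\<close>)
  qed (use D ik in auto)
  \<comment> \<open>On the sphere this is the sum of \<open>D i k\<close> over
    \<open>i \<noteq> k\<close>. The \<open>n - 1\<close> copies of \<open>- x_k f(x_k) g(P)\<close>
    and the identity \<open>\<Sum> x_i^2 = 1 - x_k^2\<close> over \<open>i \<noteq> k\<close>
    produce exactly the left side of the differential equation.\<close>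
  define E where "E k x = g' (P x) * (a k * (poly f (x k))\<^sup>2 - x k * poly f (x k) * T x) - \<mu> * poly \<phi> (x k) * g (P x)" for k x
  have E: "sphere_bounded n (E k)" if "k < n" for k
    unfolding E_def using that P T by (intro nice) auto
  have E0: "(\<integral>x. E k x \<partial>?S) = 0" if k: "k < n" for k
  proof -
    have "(\<integral>x. E k x \<partial>?S) = (\<integral>x. (\<Sum>i\<in>{..<n}-{k}. D i k x) \<partial>?S)"
    proof (rule integral_sphere_cong[OF n])
      show "sphere_bounded n (\<lambda>x. \<Sum>i\<in>{..<n}-{k}. D i k x)" using k D by (intro nice) auto
      fix x :: "nat \<Rightarrow> real" assume x: "(\<Sum>i<n. (x i)\<^sup>2) = 1"
      define p0 p1 p2 G G1 where "p0 = poly f (x k)" and "p1 = poly (pderiv f) (x k)"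
        and "p2 = poly \<phi> (x k)" and "G = g (P x)" and "G1 = g' (P x)"
      have s2: "(\<Sum>i\<in>{..<n}-{k}. (x i)\<^sup>2) = 1 - (x k)\<^sup>2" using x k by (simp add: sum_except_coord)
      have sT: "(\<Sum>i\<in>{..<n}-{k}. a i * x i * poly f (x i)) = T x - a k * x k * p0"
        using k by (simp add: sum_except_coord T_def p0_def)
      have "(\<Sum>i\<in>{..<n}-{k}. D i k x) = (\<Sum>i\<in>{..<n}-{k}. (- x k * p0 * G) + (p1 * G + a k * p0\<^sup>2 * G1) * (x i)\<^sup>2
           - (G1 * x k * p0) * (a i * x i * poly f (x i)))"
        by (rule sum.cong) (auto simp: D_def p0_def[symmetric] p1_def[symmetric] G_def[symmetric] G1_def[symmetric] algebra_simps power2_eq_square)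
      also have "\<dots> = (real n - 1) * (- x k * p0 * G) + (p1 * G + a k * p0\<^sup>2 * G1) * (1 - (x k)\<^sup>2)
           - (G1 * x k * p0) * (T x - a k * x k * p0)"
        unfolding sum.distrib sum_subtractf sum_distrib_left[symmetric] s2 sT
        using k by (simp add: of_nat_diff Suc_le_eq)
      also have "\<dots> = G * ((1 - (x k)\<^sup>2) * p1 - (real n - 1) * x k * p0) + G1 * (a k * p0\<^sup>2 - x k * p0 * T x)"
        by (simp add: algebra_simps power2_eq_square)
      also have "\<dots> = E k x" unfolding p0_def p1_def ode E_def G_def G1_def by (simp add: algebra_simps)
      finally show "E k x = (\<Sum>i\<in>{..<n}-{k}. D i k x)" by simp
    qed (use E k in auto)
    also have "\<dots> = (\<Sum>i\<in>{..<n}-{k}. \<integral>x. D i k x \<partial>?S)"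
      using k D by (intro Bochner_Integration.integral_sum integrable_sphere_bounded[OF n]) auto
    also have "\<dots> = 0" using D0 k by (intro sum.neutral) auto
    finally show ?thesis .
  qed
  define W where "W x = (\<Sum>k<n. (a k)\<^sup>2 * (poly f (x k))\<^sup>2) - (T x)\<^sup>2" for x
  have W: "sphere_bounded n W" unfolding W_def using T by (intro nice) auto
  have int: "integrable ?S (\<lambda>x. g' (P x) * W x)" "integrable ?S (\<lambda>x. P x * g (P x))"
    using P W by (intro integrable_sphere_bounded[OF n] nice; simp)+
  \<comment> \<open>Weighting by \<open>a k\<close> and summing turns \<open>\<phi>(x_k)\<close>
    into \<open>P\<close> and \<open>a_k x_k f(x_k) T\<close> into \<open>T^2\<close>.\<close>
  have "0 = (\<Sum>k<n. a k * (\<integral>x. E k x \<partial>?S))" using E0 by simp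
  also have "\<dots> = (\<integral>x. (\<Sum>k<n. a k * E k x) \<partial>?S)"
    using E integrable_sphere_bounded[OF n] by (subst Bochner_Integration.integral_sum) auto
  also have "\<dots> = (\<integral>x. g' (P x) * W x - \<mu> * (P x * g (P x)) \<partial>?S)"
  proof (rule Bochner_Integration.integral_cong[OF refl])
    fix x
    have "(\<Sum>k<n. a k * E k x) = (\<Sum>k<n. g' (P x) * ((a k)\<^sup>2 * (poly f (x k))\<^sup>2)
        - g' (P x) * T x * (a k * x k * poly f (x k)) - \<mu> * g (P x) * (a k * poly \<phi> (x k)))"
      by (rule sum.cong) (auto simp: E_def algebra_simps power2_eq_square)
    also have "\<dots> = g' (P x) * (\<Sum>k<n. (a k)\<^sup>2 * (poly f (x k))\<^sup>2) - g' (P x) * T x * T x - \<mu> * g (P x) * P x"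
      unfolding sum_subtractf sum_distrib_left[symmetric] by (simp only: T_def P_def)
    finally show "(\<Sum>k<n. a k * E k x) = g' (P x) * W x - \<mu> * (P x * g (P x))"
      by (simp add: W_def algebra_simps power2_eq_square)
  qed
  also have "\<dots> = (\<integral>x. g' (P x) * W x \<partial>?S) - \<mu> * (\<integral>x. P x * g (P x) \<partial>?S)"
    using int by simp
  finally show ?thesis by (simp add: W_def T_def)
qed

section \<open>Moments of one and of two coordinates\<close>

text \<open>\<^term>\<open>sph_mom (real n) m\<close> is the \<^term>\<open>m\<close>-th moment of a coordinate on the unit sphere of
  \<open>\<real>\<^sup>n\<close>. A real dimension is allowed because weighting by the power \<open>x\<^sub>j\<^sup>s\<close> of another coordinate
  acts like raising the dimension by \<open>s\<close>.\<close>

fun sph_mom :: "real \<Rightarrow> nat \<Rightarrow> real" where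
  "sph_mom d 0 = 1"
| "sph_mom d (Suc 0) = 0"
| "sph_mom d (Suc (Suc m)) = real (m + 1) / (d + real m) * sph_mom d m"

text \<open>Let \<open>R i\<close> be the moment with an extra factor \<open>x_i^2\<close>. These
  add up to \<open>M m s\<close> on the sphere, while integration by parts along the field for
  \<open>i\<close> and \<open>k\<close> makes each \<open>(m + 1) R i\<close> a multiple of
  \<open>M (m + 2) s\<close>: the multiple is 1 for each of the \<open>n - 2\<close> further
  indices, \<open>s + 1\<close> for \<open>i = j\<close> and, trivially, \<open>m + 1\<close> for
  \<open>i = k\<close>.\<close>

lemma integral_mixed_moment_step:
  fixes n k j m s :: nat
  assumes "k < n" "j < n" "k \<noteq> j"
  defines "M \<equiv> \<lambda>m s. \<integral>x. x k ^ m * x j ^ s \<partial>sphere_unif n"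
  shows "(real n + real m + real s) * M (m + 2) s = (real m + 1) * M m s"
proof -
  let ?S = "sphere_unif n"
  have n: "n > 0" using assms by simp
  note nice = sphere_bounded_intros
  have int: "integrable ?S (\<lambda>x. x k ^ m * x j ^ s)" for m s
    using assms by (intro integrable_sphere_bounded[OF n] nice) auto
  define R where "R i = (\<integral>x. (x i)\<^sup>2 * (x k ^ m * x j ^ s) \<partial>?S)" for i
  have intR: "integrable ?S (\<lambda>x. (x i)\<^sup>2 * (x k ^ m * x j ^ s))" if "i < n" for i
    using assms that by (intro integrable_sphere_bounded[OF n] nice) auto
  have R1: "(real m + 1) * R i = M (m + 2) s" if i: "i < n" "i \<noteq> k" "i \<noteq> j" for i
  proof -
    let ?D = "\<lambda>x. (real m + 1) * ((x i)\<^sup>2 * (x k ^ m * x j ^ s)) - x k ^ (m + 2) * x j ^ s"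
    have "(\<integral>x. ?D x \<partial>?S) = 0"
    proof (rule integral_rot_deriv[of i n k])
      show "sphere_bounded n (\<lambda>x. x i * (x k ^ (m + 1) * x j ^ s))" using assms i by (intro nice) auto
      show "sphere_bounded n ?D" using assms i by (intro nice) auto
      show "rot_deriv i k (\<lambda>x. x i * (x k ^ (m + 1) * x j ^ s)) ?D"
        by (rule rot_deriv_cong[OF rot_deriv_mult[OF rot_deriv_coord rot_deriv_mult[OF
             rot_deriv_power[OF rot_deriv_coord] rot_deriv_power[OF rot_deriv_coord]]]])
           (use assms i in \<open>auto simp: algebra_simps power2_eq_square\<close>)
    qed (use assms i in auto)
    thus ?thesis using int[of "m + 2" s] intR[OF i(1)] by (simp add: M_def R_def del: power_Suc add_2_eq_Suc')
  qed
  have R2: "(real m + 1) * R j = (real s + 1) * M (m + 2) s"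
  proof -
    let ?D = "\<lambda>x. (real m + 1) * ((x j)\<^sup>2 * (x k ^ m * x j ^ s)) - (real s + 1) * (x k ^ (m + 2) * x j ^ s)"
    have "(\<integral>x. ?D x \<partial>?S) = 0"
    proof (rule integral_rot_deriv[of j n k])
      show "sphere_bounded n (\<lambda>x. x k ^ (m + 1) * x j ^ (s + 1))" using assms by (intro nice) auto
      show "sphere_bounded n ?D" using assms by (intro nice) auto
      show "rot_deriv j k (\<lambda>x. x k ^ (m + 1) * x j ^ (s + 1)) ?D"
        by (rule rot_deriv_cong[OF rot_deriv_mult[OF
             rot_deriv_power[OF rot_deriv_coord] rot_deriv_power[OF rot_deriv_coord]]])
           (use assms in \<open>auto simp: algebra_simps power2_eq_square\<close>)
    qed (use assms in auto)
    thus ?thesis using int[of "m + 2" s] intR[OF assms(2)] by (simp add: M_def R_def del: power_Suc add_2_eq_Suc')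
  qed
  have Rk: "R k = M (m + 2) s"
    unfolding R_def M_def by (rule Bochner_Integration.integral_cong) (auto simp: power2_eq_square)
  have "M m s = (\<integral>x. (\<Sum>i<n. (x i)\<^sup>2 * (x k ^ m * x j ^ s)) \<partial>?S)"
    unfolding M_def
  proof (rule integral_sphere_cong[OF n])
    show "sphere_bounded n (\<lambda>x. \<Sum>i<n. (x i)\<^sup>2 * (x k ^ m * x j ^ s))" "sphere_bounded n (\<lambda>x. x k ^ m * x j ^ s)"
      using assms by (intro nice; simp)+
  qed (simp add: sum_distrib_right[symmetric])
  also have "\<dots> = (\<Sum>i<n. R i)"
    unfolding R_def using intR by (intro Bochner_Integration.integral_sum) auto
  also have "{..<n} = insert k (insert j ({..<n} - {k, j}))" using assms by auto
  finally have "M m s = R k + (R j + (\<Sum>i\<in>{..<n} - {k, j}. R i))" using assms by simp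
  hence "(real m + 1) * M m s = (real m + 1) * R k + (real m + 1) * R j + (\<Sum>i\<in>{..<n} - {k, j}. (real m + 1) * R i)"
    by (simp add: algebra_simps sum_distrib_left)
  also have "(\<Sum>i\<in>{..<n} - {k, j}. (real m + 1) * R i) = (\<Sum>i\<in>{..<n} - {k, j}. M (m + 2) s)"
    using R1 by (intro sum.cong) auto
  also have "\<dots> = (real n - 2) * M (m + 2) s"
    using assms by (simp add: card_Diff_subset of_nat_diff)
  finally show ?thesis unfolding R2 Rk by (simp add: algebra_simps)
qed

text \<open>For \<open>n \<ge> 3\<close> there is a third index \<open>i\<close>, and the field for
  \<open>i\<close> and \<open>k\<close> sends \<open>x_i x_j^s\<close> to
  \<open>- x_k x_j^s\<close>.\<close>

lemma integral_mixed_moment_1: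
  assumes "k < n" "j < n" "k \<noteq> j" "n \<ge> 3"
  shows "(\<integral>x. x k * x j ^ s \<partial>sphere_unif n) = 0"
proof -
  have "card ({..<n} - {k, j}) \<noteq> 0" using assms by (simp add: card_Diff_subset)
  then obtain i where i: "i < n" "i \<noteq> k" "i \<noteq> j" by (metis Diff_iff card.empty equals0I insertCI lessThan_iff)
  let ?D = "\<lambda>x. - (x k * x j ^ s)"
  have "(\<integral>x. ?D x \<partial>sphere_unif n) = 0"
  proof (rule integral_rot_deriv[of i n k])
    show "sphere_bounded n (\<lambda>x. x i * x j ^ s)" "sphere_bounded n ?D"
      using assms i by (intro sphere_bounded_intros; simp)+
    show "rot_deriv i k (\<lambda>x. x i * x j ^ s) ?D"
      by (rule rot_deriv_cong[OF rot_deriv_mult[OF rot_deriv_coord rot_deriv_power[OF rot_deriv_coord]]])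
         (use assms i in auto)
  qed (use assms i in auto)
  thus ?thesis by simp
qed

lemma integral_mixed_moment_aux:
  assumes "k < n" "j < n" "k \<noteq> j" "n \<ge> 3"
  shows "(\<integral>x. x k ^ m * x j ^ s \<partial>sphere_unif n) = sph_mom (real n + real s) m * (\<integral>x. x j ^ s \<partial>sphere_unif n)"
proof (induction m rule: induct_nat_012)
  case (ge2 m)
  have "(real n + real m + real s) * (\<integral>x. x k ^ Suc (Suc m) * x j ^ s \<partial>sphere_unif n)
     = (real m + 1) * (\<integral>x. x k ^ m * x j ^ s \<partial>sphere_unif n)"
    using integral_mixed_moment_step[OF assms(1-3), of m s] by simp
  moreover have "real n + real m + real s > 0" using assms by simp
  ultimately show ?case unfolding ge2 by (simp add: field_simps)
qed (use integral_mixed_moment_1[OF assms] in auto)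

lemma integral_coord_power:
  assumes "k < n" "n \<ge> 3"
  shows "(\<integral>x. x k ^ m \<partial>sphere_unif n) = sph_mom (real n) m"
proof -
  interpret prob_space "sphere_unif n" using assms by (intro prob_space_sphere_unif) simp
  define j :: nat where "j = (if k = 0 then 1 else 0)"
  have "j < n" "k \<noteq> j" using assms by (auto simp: j_def)
  from integral_mixed_moment_aux[OF assms(1) this assms(2), of m 0] show ?thesis
    using prob_space by (simp del: sphere_unif_simps)
qed

lemma integral_mixed_moment:
  assumes "k < n" "j < n" "k \<noteq> j" "n \<ge> 3"
  shows "(\<integral>x. x k ^ m * x j ^ s \<partial>sphere_unif n) = sph_mom (real n + real s) m * sph_mom (real n) s"
  using integral_mixed_moment_aux[OF assms] integral_coord_power assms by simp

lemma sph_mom_nonneg: "d \<ge> 0 \<Longrightarrow> sph_mom d m \<ge> 0"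
  by (induction d m rule: sph_mom.induct) auto

lemma sph_mom_odd: "odd m \<Longrightarrow> sph_mom d m = 0"
  by (induction d m rule: sph_mom.induct) auto

text \<open>After rescaling by \<open>sqrt d\<close>, each step of the recursion multiplies by
  \<open>(m + 1) * d / (d + m)\<close>, which is at most \<open>m + 1\<close>. The factorial is a
  crude bound for the resulting double factorial, but it is free of the dimension.\<close>

lemma sph_mom_scaled_le: "d \<ge> 1 \<Longrightarrow> sph_mom d m * sqrt d ^ m \<le> fact m"
proof (induction d m rule: sph_mom.induct)
  case (3 d m)
  have sq: "sqrt d * sqrt d = d" using 3 by simp
  have "sph_mom d (Suc (Suc m)) * sqrt d ^ Suc (Suc m) = (sqrt d * sqrt d) / (d + m) * (real (m + 1) * (sph_mom d m * sqrt d ^ m))"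
    unfolding sph_mom.simps power_Suc by (simp only: divide_inverse mult_ac)
  also have "\<dots> \<le> 1 * (real (m + 1) * fact m)"
    unfolding sq using 3 sph_mom_nonneg[of d m] by (intro mult_mono) (auto simp: field_simps)
  also have "\<dots> \<le> fact (Suc (Suc m))"
    by (simp add: algebra_simps)
  finally show ?case .
qed auto

text \<open>Raising the dimension by \<open>s\<close> shrinks each factor of the recursion by a
  relative amount of at most \<open>s / d\<close>. The induction spends \<open>2 * s / d\<close> per
  step of two in \<open>m\<close>, which gives the total \<open>m * s / d\<close>. This is the
  source of the \<open>1 / n\<close> in the covariance bound.\<close>

lemma sph_mom_shift_bounds:
  assumes "d \<ge> 1"
  shows "sph_mom (d + real s) m \<le> sph_mom d m \<and> (1 - real m * real s / d) * sph_mom d m \<le> sph_mom (d + real s) m"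
  using assms
proof (induction d m rule: sph_mom.induct)
  case (3 d m)
  have d: "d \<ge> 1" "d > 0" using 3 by auto
  have IH: "sph_mom (d + real s) m \<le> sph_mom d m" "(1 - real m * real s / d) * sph_mom d m \<le> sph_mom (d + real s) m"
    using 3 by auto
  note nn = sph_mom_nonneg[of d m]
  define r where "r = (d + real m) / (d + real s + real m)"
  have r: "0 \<le> r" "r \<le> 1" using d by (auto simp: r_def)
  have r1: "1 - r \<le> real s / d"
  proof -
    have "1 - r = real s / (d + real s + real m)" using d by (simp add: r_def field_simps)
    also have "\<dots> \<le> real s / d" using d by (intro divide_left_mono) auto
    finally show ?thesis .
  qed
  have e: "sph_mom (d + real s) (Suc (Suc m)) = real (m + 1) / (d + real m) * (r * sph_mom (d + real s) m)"
    using d by (simp add: r_def)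
  have up: "r * sph_mom (d + real s) m \<le> sph_mom d m"
    using r IH nn d sph_mom_nonneg[of "d + real s" m] by (intro order_trans[OF mult_left_le_one_le]) auto
  have "(1 - real (Suc (Suc m)) * real s / d) \<le> r * (1 - real m * real s / d)"
  proof -
    have "r * (real m * real s / d) \<le> 1 * (real m * real s / d)" using r d by (intro mult_right_mono) auto
    moreover have "real (Suc (Suc m)) * real s / d = real m * real s / d + real s / d + real s / d" by (simp add: algebra_simps add_divide_distrib)
    moreover have "0 \<le> real s / d" using d by simp
    ultimately show ?thesis using r1 by (simp add: right_diff_distrib)
  qed
  hence "(1 - real (Suc (Suc m)) * real s / d) * sph_mom d m \<le> r * (1 - real m * real s / d) * sph_mom d m"
    using nn d by (intro mult_right_mono) auto
  also have "\<dots> \<le> r * sph_mom (d + real s) m" using mult_left_mono[OF IH(2) r(1)] by (simp add: mult.assoc)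
  finally have lo: "(1 - real (Suc (Suc m)) * real s / d) * sph_mom d m \<le> r * sph_mom (d + real s) m" .
  have q: "0 \<le> real (m + 1) / (d + real m)" using d by simp
  show ?case unfolding e sph_mom.simps(3)[of d m]
    using mult_left_mono[OF up q] mult_left_mono[OF lo q] by (simp only: mult.left_commute mult.assoc conj_absorb)
qed auto

text \<open>For even \<open>m\<close> the denominators are \<open>d (d + 2) ... (d + m - 2)\<close>
  and \<open>(d + 2) ... (d + m)\<close>, which differ only in the end factors; for odd
  \<open>m\<close> both moments vanish.\<close>

lemma sph_mom_dim_shift: "d > 0 \<Longrightarrow> d * sph_mom d m = (d + real m) * sph_mom (d + 2) m"
proof (induction d m rule: sph_mom.induct)
  case (3 d m)
  have "(d + real (Suc (Suc m))) * sph_mom (d + 2) (Suc (Suc m)) = real (m + 1) * sph_mom (d + 2) m"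
    using 3 by (simp add: add_pos_nonneg field_simps)
  also have "\<dots> = real (m + 1) / (d + real m) * ((d + real m) * sph_mom (d + 2) m)"
    using 3 by (simp add: field_simps)
  also have "\<dots> = real (m + 1) / (d + real m) * (d * sph_mom d m)" using 3 by simp
  finally show ?case by (simp only: sph_mom.simps(3) mult.left_commute mult.assoc)
qed auto

subsection \<open>Gegenbauer polynomials\<close>

lemma poly_altdef_le:
  fixes p :: "'a::comm_semiring_1 poly"
  assumes "degree p \<le> d" shows "poly p x = (\<Sum>m\<le>d. coeff p m * x ^ m)"
  unfolding poly_altdef using assms by (intro sum.mono_neutral_left) (auto simp: coeff_eq_0)

lemma integral_poly_coord:
  assumes "k < n" "n \<ge> 3" "degree p \<le> d"
  shows "(\<integral>x. poly p (x k) \<partial>sphere_unif n) = (\<Sum>m\<le>d. coeff p m * sph_mom (real n) m)"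
proof -
  have "(\<integral>x. poly p (x k) \<partial>sphere_unif n) = (\<integral>x. (\<Sum>m\<le>d. coeff p m * x k ^ m) \<partial>sphere_unif n)"
    using assms by (simp add: poly_altdef_le)
  also have "\<dots> = (\<Sum>m\<le>d. \<integral>x. coeff p m * x k ^ m \<partial>sphere_unif n)"
    using assms by (intro Bochner_Integration.integral_sum integrable_sphere_bounded sphere_bounded_intros) auto
  finally show ?thesis using assms by (simp add: integral_coord_power)
qed

text \<open>A coordinate has density proportional to \<open>(1 - t^2)^((n - 3) / 2)\<close>, so a
  factor \<open>1 - t^2\<close> amounts to two more dimensions. The proof sees this through moments
  alone. It matches differentiation of Gegenbauer polynomials, which raises \<open>\<kappa>\<close>
  by 1 and hence the dimension by 2.\<close>

lemma integral_poly_dim_shift: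
  assumes "k < n" "n \<ge> 3"
  shows "(\<integral>x. (1 - (x k)\<^sup>2) * poly p (x k) \<partial>sphere_unif n)
    = (real n - 1) / real n * (\<integral>x. poly p (x k) \<partial>sphere_unif (n + 2))"
proof -
  define d where "d = degree p"
  have "(\<integral>x. (1 - (x k)\<^sup>2) * poly p (x k) \<partial>sphere_unif n) =
     (\<integral>x. (\<Sum>m\<le>d. coeff p m * (x k ^ m - x k ^ Suc (Suc m))) \<partial>sphere_unif n)"
  proof (rule Bochner_Integration.integral_cong[OF refl])
    fix x :: "nat \<Rightarrow> real"
    show "(1 - (x k)\<^sup>2) * poly p (x k) = (\<Sum>m\<le>d. coeff p m * (x k ^ m - x k ^ Suc (Suc m)))"
      unfolding poly_altdef sum_distrib_left d_def
      by (rule sum.cong) (auto simp: algebra_simps power2_eq_square)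
  qed
  also have "\<dots> = (\<Sum>m\<le>d. \<integral>x. coeff p m * (x k ^ m - x k ^ Suc (Suc m)) \<partial>sphere_unif n)"
    using assms by (intro Bochner_Integration.integral_sum integrable_sphere_bounded sphere_bounded_intros) auto
  also have "\<dots> = (\<Sum>m\<le>d. (real n - 1) / real n * (coeff p m * sph_mom (real (n + 2)) m))"
  proof (rule sum.cong[OF refl])
    fix m
    have i: "integrable (sphere_unif n) (\<lambda>x. x k ^ m)" for m
      using assms by (intro integrable_sphere_bounded sphere_bounded_intros) auto
    have "sph_mom (real n) m - sph_mom (real n) (Suc (Suc m)) = (real n - 1) / (real n + real m) * sph_mom (real n) m"
      using assms by (simp add: field_simps)
    also have "\<dots> = (real n - 1) / (real n * (real n + real m)) * (real n * sph_mom (real n) m)"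
      using assms by simp
    also have "\<dots> = (real n - 1) / real n * sph_mom (real n + 2) m"
      using assms by (subst sph_mom_dim_shift) (auto simp: add_eq_0_iff)
    finally have "sph_mom (real n) m - sph_mom (real n) (Suc (Suc m)) = (real n - 1) / real n * sph_mom (real n + 2) m" .
    moreover have "(\<integral>x. coeff p m * (x k ^ m - x k ^ Suc (Suc m)) \<partial>sphere_unif n)
       = coeff p m * (sph_mom (real n) m - sph_mom (real n) (Suc (Suc m)))"
      using assms i[of m] i[of "Suc (Suc m)"]
      by (simp add: integral_coord_power del: power_Suc sph_mom.simps)
    ultimately show "(\<integral>x. coeff p m * (x k ^ m - x k ^ Suc (Suc m)) \<partial>sphere_unif n)
       = (real n - 1) / real n * (coeff p m * sph_mom (real (n + 2)) m)"
      by (simp add: add.commute)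
  qed
  also have "\<dots> = (real n - 1) / real n * (\<integral>x. poly p (x k) \<partial>sphere_unif (n + 2))"
    using assms integral_poly_coord[of k "n + 2" p d] by (simp add: sum_distrib_left d_def)
  finally show ?thesis .
qed

text \<open>The Stein identity for the identity function \<open>g\<close> and the coefficient vector
  concentrated at \<open>k\<close>.\<close>

lemma integral_dirichlet_form:
  assumes "k < n" "n \<ge> 3"
    and ode: "\<And>t. (1 - t\<^sup>2) * poly (pderiv (pderiv \<phi>)) t - (real n - 1) * t * poly (pderiv \<phi>) t = - \<mu> * poly \<phi> t"
  shows "\<mu> * (\<integral>x. (poly \<phi> (x k))\<^sup>2 \<partial>sphere_unif n) = (\<integral>x. (1 - (x k)\<^sup>2) * (poly (pderiv \<phi>) (x k))\<^sup>2 \<partial>sphere_unif n)"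
proof -
  define a :: "nat \<Rightarrow> real" where "a i = (if i = k then 1 else 0)" for i
  have s: "(\<Sum>i<n. a i * c i) = c k" "(\<Sum>i<n. (a i)\<^sup>2 * c i) = c k" for c
    using assms by (simp_all add: a_def if_distrib[of "\<lambda>u. u * _"] if_distrib[of "\<lambda>u. u ^ _"] cong: if_cong)
  have "\<mu> * (\<integral>x. (poly \<phi> (x k)) * (poly \<phi> (x k)) \<partial>sphere_unif n) =
    (\<integral>x. 1 * ((poly (pderiv \<phi>) (x k))\<^sup>2 - (x k * poly (pderiv \<phi>) (x k))\<^sup>2) \<partial>sphere_unif n)"
    using stein_identity[of n \<phi> \<mu> "\<lambda>y. y" "\<lambda>_. 1" a] assms by (simp add: s mult.assoc)
  thus ?thesis by (simp add: power2_eq_square algebra_simps)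
qed

text \<open>The summand of \<open>gegenbauer\<close> with \<open>j = (l - m) div 2\<close>. Indexing
  by the power \<open>m\<close> and writing the quotient of Gamma values as a Pochhammer symbol
  allows derivatives and the differential equation to be checked coefficient by coefficient.\<close>

definition geg_coeff :: "real \<Rightarrow> nat \<Rightarrow> nat \<Rightarrow> real" where
  "geg_coeff \<kappa> l m = (if m \<le> l \<and> even (l - m) then
     (-1) ^ ((l - m) div 2) * 2 ^ m * pochhammer \<kappa> ((l + m) div 2) / (fact ((l - m) div 2) * fact m) else 0)"

definition geg_poly :: "real \<Rightarrow> nat \<Rightarrow> real poly" where
  "geg_poly \<kappa> l = (\<Sum>m\<le>l. monom (geg_coeff \<kappa> l m) m)"

lemma coeff_geg_poly: "coeff (geg_poly \<kappa> l) m = geg_coeff \<kappa> l m"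
proof -
  have "coeff (geg_poly \<kappa> l) m = (\<Sum>i\<le>l. if i = m then geg_coeff \<kappa> l i else 0)"
    unfolding geg_poly_def by (simp add: coeff_sum)
  also have "\<dots> = geg_coeff \<kappa> l m" by (auto simp: geg_coeff_def)
  finally show ?thesis .
qed

lemma degree_geg_poly: "degree (geg_poly \<kappa> l) \<le> l"
  by (rule degree_le) (auto simp: coeff_geg_poly geg_coeff_def)

lemma poly_geg_poly:
  assumes "\<kappa> > 0" shows "poly (geg_poly \<kappa> l) t = gegenbauer \<kappa> l t"
proof -
  have nz: "\<kappa> \<notin> \<int>\<^sub>\<le>\<^sub>0" using assms nonpos_Ints_nonpos by force
  have "poly (geg_poly \<kappa> l) t = (\<Sum>m\<le>l. geg_coeff \<kappa> l m * t ^ m)"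
    unfolding geg_poly_def by (simp add: poly_sum poly_monom)
  also have "\<dots> = (\<Sum>m\<in>{m. m \<le> l \<and> even (l - m)}. geg_coeff \<kappa> l m * t ^ m)"
    by (rule sum.mono_neutral_right) (auto simp: geg_coeff_def)
  also have "\<dots> = (\<Sum>j\<le>l div 2. geg_coeff \<kappa> l (l - 2 * j) * t ^ (l - 2 * j))"
    by (rule sum.reindex_bij_witness[of _ "\<lambda>j. l - 2 * j" "\<lambda>m. (l - m) div 2"]) auto
  also have "\<dots> = (\<Sum>j\<le>l div 2. 2 ^ l / Gamma \<kappa> * ((-1) ^ j * Gamma (\<kappa> + real l - real j) /
        (2 ^ (2 * j) * fact j * fact (l - 2 * j)) * t ^ (l - 2 * j)))"
  proof (rule sum.cong[OF refl])
    fix j assume "j \<in> {..l div 2}"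
    hence j: "2 * j \<le> l" by auto
    have e: "l - (l - 2 * j) = 2 * j" "(l + (l - 2 * j)) div 2 = l - j" "\<kappa> + real l - real j = \<kappa> + real (l - j)"
      using j by (auto simp: of_nat_diff)
    have p: "(2::real) ^ l = 2 ^ (l - 2 * j) * 2 ^ (2 * j)" using j by (simp add: power_add[symmetric])
    show "geg_coeff \<kappa> l (l - 2 * j) * t ^ (l - 2 * j) = 2 ^ l / Gamma \<kappa> * ((-1) ^ j * Gamma (\<kappa> + real l - real j) /
        (2 ^ (2 * j) * fact j * fact (l - 2 * j)) * t ^ (l - 2 * j))"
      unfolding geg_coeff_def e p using Gamma_real_pos[OF assms] nz by (simp add: pochhammer_Gamma)
  qed
  finally show ?thesis unfolding gegenbauer_def sum_distrib_left .
qed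

lemma pderiv_geg_poly: "pderiv (geg_poly \<kappa> (Suc l)) = smult (2 * \<kappa>) (geg_poly (\<kappa> + 1) l)"
proof (rule poly_eqI)
  fix m
  show "coeff (pderiv (geg_poly \<kappa> (Suc l))) m = coeff (smult (2 * \<kappa>) (geg_poly (\<kappa> + 1) l)) m"
  proof (cases "m \<le> l \<and> even (l - m)")
    case True
    have "real (Suc m) * (X * (2 * 2 ^ m) * (\<kappa> * P) / (F * (real (Suc m) * fact m))) = 2 * \<kappa> * (X * 2 ^ m * P / (F * fact m))" for X P F
      by (simp add: divide_simps del: of_nat_Suc)
    thus ?thesis using True
      by (simp add: coeff_pderiv coeff_geg_poly geg_coeff_def pochhammer_rec del: of_nat_Suc)
  qed (auto simp: coeff_pderiv coeff_geg_poly geg_coeff_def)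
qed

text \<open>The Gegenbauer equation read off at \<open>t^m\<close>. With
  \<open>l = m + 2 * j\<close> the eigenvalue difference is \<open>- 4 j (\<kappa> + m + j)\<close>,
  which is what the factorial of \<open>j\<close> and the last Pochhammer factor contribute.\<close>

lemma geg_coeff_rec:
  "real (m + 2) * (real (m + 1) * geg_coeff \<kappa> l (m + 2)) =
   (real m * (real m + 2 * \<kappa>) - real l * (real l + 2 * \<kappa>)) * geg_coeff \<kappa> l m"
proof (cases "m \<le> l \<and> even (l - m)")
  case True
  then obtain j where j: "l = m + 2 * j" by (metis dvdE le_add_diff_inverse)
  show ?thesis
  proof (cases j)
    case 0
    thus ?thesis using j by (simp add: geg_coeff_def)
  next
    case (Suc i)
    have e: "(l - (m + 2)) div 2 = i" "(l + (m + 2)) div 2 = Suc (m + j)" "(l - m) div 2 = Suc i" "(l + m) div 2 = m + j"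
      using j Suc by auto
    have f: "(fact (m + 2) :: real) = real (m + 2) * (real (m + 1) * fact m)" by (simp add: algebra_simps)
    have "real (m + 2) * (real (m + 1) * geg_coeff \<kappa> l (m + 2)) =
       (-1) ^ i * 2 ^ (m + 2) * pochhammer \<kappa> (Suc (m + j)) / (fact i * fact m)"
      unfolding geg_coeff_def e f using j Suc by (simp add: divide_simps del: of_nat_add)
    also have "\<dots> = - (4 * real (Suc i) * (\<kappa> + real (m + j))) * ((-1) ^ Suc i * 2 ^ m * pochhammer \<kappa> (m + j) / (fact (Suc i) * fact m))"
      by (simp add: pochhammer_Suc divide_simps del: of_nat_add of_nat_Suc)
    also have "\<dots> = - (4 * real j * (\<kappa> + real (m + j))) * geg_coeff \<kappa> l m"
      unfolding geg_coeff_def e using j Suc by simp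
    also have "- (4 * real j * (\<kappa> + real (m + j))) = real m * (real m + 2 * \<kappa>) - real l * (real l + 2 * \<kappa>)"
      by (simp add: j algebra_simps)
    finally show ?thesis .
  qed
next
  case False
  hence F2: "\<not> (m + 2 \<le> l \<and> even (l - (m + 2)))" by auto
  show ?thesis unfolding geg_coeff_def if_not_P[OF False] if_not_P[OF F2] by simp
qed

lemma geg_poly_ode:
  fixes \<kappa> t :: real and l :: nat
  defines "f \<equiv> pderiv (geg_poly \<kappa> l)"
  shows "(1 - t\<^sup>2) * poly (pderiv f) t - (2 * \<kappa> + 1) * t * poly f t = - (real l * (real l + 2 * \<kappa>)) * poly (geg_poly \<kappa> l) t"
proof -
  \<comment> \<open>The equation as an identity between polynomials; \<open>pCons 0\<close>
    multiplies by the variable.\<close>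
  have "pderiv f - pCons 0 (pCons 0 (pderiv f)) - smult (2 * \<kappa> + 1) (pCons 0 f)
      = smult (- (real l * (real l + 2 * \<kappa>))) (geg_poly \<kappa> l)" (is "?L = ?R")
  proof (rule poly_eqI)
    fix m
    have r: "real (m + 2) * (real (m + 1) * geg_coeff \<kappa> l (m + 2)) =
      (real m * (real m + 2 * \<kappa>) - real l * (real l + 2 * \<kappa>)) * geg_coeff \<kappa> l m" by (rule geg_coeff_rec)
    have "coeff ?L m = real (m + 2) * (real (m + 1) * geg_coeff \<kappa> l (m + 2))
       - (real m * (real m + 2 * \<kappa>)) * geg_coeff \<kappa> l m"
      by (cases m rule: old.nat.exhaust; cases "m - 1")
         (auto simp: f_def coeff_pderiv coeff_geg_poly coeff_pCons algebra_simps split: nat.splits)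
    also have "\<dots> = coeff ?R m" unfolding r by (simp add: coeff_geg_poly algebra_simps)
    finally show "coeff ?L m = coeff ?R m" .
  qed
  hence "poly ?L t = poly ?R t" by simp
  thus ?thesis by (simp add: algebra_simps power2_eq_square)
qed

text \<open>The Dirichlet form trades the norm in degree \<open>l + 1\<close> for that of the
  derivative with weight \<open>1 - t^2\<close>. Since the derivative is \<open>2 \<kappa>\<close>
  times the polynomial of degree \<open>l\<close> for \<open>\<kappa> + 1\<close>, and the weight
  shifts the dimension to \<open>n + 2\<close>, the induction on the degree must let
  \<open>n\<close> vary.\<close>

lemma integral_geg_poly_squared:
  assumes "k < n" "n \<ge> 3"
  shows "(\<integral>x. (poly (geg_poly ((real n - 2) / 2) l) (x k))\<^sup>2 \<partial>sphere_unif n)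
    = fact (n + l - 3) * (real n - 2) / (fact (n - 3) * fact l * (real n + 2 * real l - 2))"
  using assms
proof (induction l arbitrary: n)
  case 0
  interpret prob_space "sphere_unif n" using 0 by (intro prob_space_sphere_unif) simp
  have "geg_poly \<kappa> 0 = [:1:]" for \<kappa> by (simp add: geg_poly_def geg_coeff_def monom_0)
  thus ?case using 0 prob_space by (simp del: sphere_unif_simps)
next
  case (Suc l)
  define \<kappa> where "\<kappa> = (real n - 2) / 2"
  have k2: "2 * \<kappa> = real n - 2" by (metis \<kappa>_def nonzero_mult_div_cancel_left times_divide_eq_right zero_neq_numeral)
  define \<mu> where "\<mu> = real (Suc l) * (real (Suc l) + 2 * \<kappa>)"
  define I where "I = (\<integral>x. (poly (geg_poly \<kappa> (Suc l)) (x k))\<^sup>2 \<partial>sphere_unif n)"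
  define J where "J = (\<integral>x. (poly (geg_poly (\<kappa> + 1) l) (x k))\<^sup>2 \<partial>sphere_unif (n + 2))"
  have k1: "\<kappa> + 1 = (real (n + 2) - 2) / 2" by (simp add: \<kappa>_def diff_divide_distrib)
  have J: "J = fact (n + 2 + l - 3) * (real (n + 2) - 2) / (fact (n + 2 - 3) * fact l * (real (n + 2) + 2 * real l - 2))"
    unfolding J_def k1 by (rule Suc.IH) (use Suc in auto)
  have "\<mu> * I = (\<integral>x. (1 - (x k)\<^sup>2) * (poly (pderiv (geg_poly \<kappa> (Suc l))) (x k))\<^sup>2 \<partial>sphere_unif n)"
    unfolding I_def
  proof (rule integral_dirichlet_form[OF Suc.prems])
    have n1: "real n - 1 = 2 * \<kappa> + 1" by (simp add: k2)
    show "(1 - t\<^sup>2) * poly (pderiv (pderiv (geg_poly \<kappa> (Suc l)))) t - (real n - 1) * t * poly (pderiv (geg_poly \<kappa> (Suc l))) t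
       = - \<mu> * poly (geg_poly \<kappa> (Suc l)) t" for t
      unfolding n1 \<mu>_def by (rule geg_poly_ode)
  qed
  also have "\<dots> = (\<integral>x. (2 * \<kappa>)\<^sup>2 * ((1 - (x k)\<^sup>2) * poly ((geg_poly (\<kappa> + 1) l)\<^sup>2) (x k)) \<partial>sphere_unif n)"
    unfolding pderiv_geg_poly by (rule Bochner_Integration.integral_cong) (auto simp: power_mult_distrib)
  also have "\<dots> = (2 * \<kappa>)\<^sup>2 * ((real n - 1) / real n * J)"
    unfolding J_def using integral_poly_dim_shift[OF Suc.prems, of "(geg_poly (\<kappa> + 1) l)\<^sup>2"] by (simp add: poly_power)
  finally have eq: "\<mu> * I = (real n - 2)\<^sup>2 * ((real n - 1) / real n * J)" by (simp only: k2)
  obtain n' where n': "n = n' + 3" using Suc.prems by (metis add.commute le_Suc_ex)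
  have mu: "\<mu> = (real l + 1) * (real n' + real l + 2)" unfolding \<mu>_def k2 by (simp add: n' algebra_simps)
  have f1: "(fact (n + 2 + l - 3) :: real) = (real n' + real l + 2) * fact (n' + Suc l)"
    by (simp add: n' algebra_simps)
  have f2: "(fact (n + 2 - 3) :: real) = (real n' + 2) * ((real n' + 1) * fact n')"
    by (simp add: n' algebra_simps)
  define a b c :: real where "a = fact (n' + Suc l)" and "b = fact n'" and "c = fact l"
  have pos: "b > 0" "c > 0" by (auto simp: b_def c_def)
  have J': "J = (real n' + real l + 2) * a * (real n' + 3) / ((real n' + 2) * ((real n' + 1) * b) * c * (real n' + 2 * real l + 3))"
    unfolding J f1 f2 a_def b_def c_def by (simp add: n' algebra_simps)
  have mu0: "\<mu> > 0" unfolding mu by (intro mult_pos_pos) auto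
  have "I = (\<mu> * I) / \<mu>" using mu0 by simp
  also have "\<dots> = ((real n' + 1)\<^sup>2 * ((real n' + 2) / (real n' + 3) * J)) / ((real l + 1) * (real n' + real l + 2))"
  proof -
    have r: "real n - 2 = real n' + 1" "real n - 1 = real n' + 2" "real n = real n' + 3" by (simp_all add: n')
    show ?thesis by (simp only: eq r(1,2)) (simp only: r(3) mu)
  qed
  also have "\<dots> = a * (real n' + 1) / (b * ((real l + 1) * c) * (real n' + 2 * real l + 3))"
  proof -
    have nz: "real n' + 1 \<noteq> 0" "real n' + 2 \<noteq> 0" "real n' + 3 \<noteq> 0" "real l + 1 \<noteq> 0" "real n' + real l + 2 \<noteq> 0"
      "real n' + 2 * real l + 3 \<noteq> 0" "b \<noteq> 0" "c \<noteq> 0" using pos by linarith+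
    have "(u\<^sup>2 * (v / w * (z * a * w / (v * (u * b) * c * y)))) / (s * z) = a * u / (b * (s * c) * y)"
      if "u \<noteq> 0" "v \<noteq> 0" "w \<noteq> 0" "s \<noteq> 0" "z \<noteq> 0" "y \<noteq> 0" for u v w s z y :: real
      using that nz(7,8) by (simp add: power2_eq_square) (simp only: mult_ac)
    from this[OF nz(1-6)] show ?thesis unfolding J' .
  qed
  finally show ?case unfolding I_def \<kappa>_def a_def b_def c_def by (simp add: n' algebra_simps)
qed

subsection \<open>Coefficient bounds uniform in the dimension\<close>

text \<open>On the sphere of \<open>\<real>\<^sup>n\<close> a coordinate has size about \<open>n\<^sup>-\<^sup>1\<^sup>/\<^sup>2\<close>, so this is the natural scale on which to
  measure coefficients uniformly in \<open>n\<close>.\<close>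

definition coeffs_bounded :: "real \<Rightarrow> nat \<Rightarrow> real poly \<Rightarrow> bool" where
  "coeffs_bounded K n p \<longleftrightarrow> (\<forall>m. \<bar>coeff p m\<bar> \<le> K * sqrt (real n) ^ m)"

text \<open>A coefficient of the product is a convolution of at most \<open>d + 1\<close> terms, and
  the scale \<open>sqrt n ^ m\<close> is multiplicative.\<close>

lemma coeffs_bounded_mult:
  assumes p: "coeffs_bounded K n p" and q: "coeffs_bounded L n q" and d: "degree (p * q) \<le> d" and KL: "K \<ge> 0" "L \<ge> 0"
  shows "coeffs_bounded (real (d + 1) * K * L) n (p * q)"
  unfolding coeffs_bounded_def
proof
  fix m
  show "\<bar>coeff (p * q) m\<bar> \<le> real (d + 1) * K * L * sqrt (real n) ^ m"
  proof (cases "m \<le> d")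
    case True
    have "\<bar>coeff (p * q) m\<bar> \<le> (\<Sum>i\<le>m. \<bar>coeff p i * coeff q (m - i)\<bar>)"
      unfolding coeff_mult by (rule sum_abs)
    also have "\<dots> \<le> (\<Sum>i\<le>m. K * L * sqrt (real n) ^ m)"
    proof (rule sum_mono)
      fix i assume i: "i \<in> {..m}"
      have "\<bar>coeff p i\<bar> * \<bar>coeff q (m - i)\<bar> \<le> (K * sqrt (real n) ^ i) * (L * sqrt (real n) ^ (m - i))"
        using p q KL unfolding coeffs_bounded_def by (intro mult_mono) auto
      also have "\<dots> = K * L * (sqrt (real n) ^ (i + (m - i)))" by (simp only: power_add mult_ac)
      finally show "\<bar>coeff p i * coeff q (m - i)\<bar> \<le> K * L * sqrt (real n) ^ m" using i by (simp add: abs_mult)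
    qed
    also have "\<dots> = real (m + 1) * (K * L * sqrt (real n) ^ m)" by simp
    also have "\<dots> \<le> real (d + 1) * (K * L * sqrt (real n) ^ m)" using True KL by (intro mult_right_mono) auto
    finally show ?thesis by (simp only: mult.assoc)
  next
    case False
    thus ?thesis using d KL by (simp add: coeff_eq_0)
  qed
qed

lemma abs_sum_atMost_le:
  assumes "\<And>m. m \<le> (d::nat) \<Longrightarrow> \<bar>f m\<bar> \<le> (g m :: real)"
  shows "\<bar>\<Sum>m\<le>d. f m\<bar> \<le> (\<Sum>m\<le>d. g m)"
  using assms by (intro order_trans[OF sum_abs sum_mono]) auto

text \<open>The permitted growth \<open>sqrt n ^ m\<close> of the coefficient is cancelled by the
  decay of the \<open>m\<close>-th moment, so the bound is independent of \<open>n\<close>.\<close>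

lemma coeff_moment_bound:
  assumes "coeffs_bounded K n p" "n \<ge> 3" "K \<ge> 0"
  shows "\<bar>coeff p m * sph_mom (real n) m\<bar> \<le> K * fact m"
proof -
  have s: "sph_mom (real n) m \<ge> 0" by (rule sph_mom_nonneg) simp
  have "\<bar>coeff p m * sph_mom (real n) m\<bar> \<le> (K * sqrt (real n) ^ m) * sph_mom (real n) m"
    using assms s unfolding coeffs_bounded_def by (simp add: abs_mult mult_right_mono)
  also have "\<dots> = K * (sph_mom (real n) m * sqrt (real n) ^ m)" by simp
  also have "\<dots> \<le> K * fact m" using assms by (intro mult_left_mono sph_mom_scaled_le) auto
  finally show ?thesis .
qed

lemma integral_poly_coord_bound:
  assumes "coeffs_bounded K n p" "degree p \<le> d" "k < n" "n \<ge> 3" "K \<ge> 0"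
  shows "\<bar>\<integral>x. poly p (x k) \<partial>sphere_unif n\<bar> \<le> K * (\<Sum>m\<le>d. fact m)"
  unfolding integral_poly_coord[OF assms(3,4,2)] sum_distrib_left
  by (intro abs_sum_atMost_le coeff_moment_bound assms)

lemma integral_poly_prod:
  assumes "k < n" "j < n" "k \<noteq> j" "n \<ge> 3" "degree p \<le> d" "degree q \<le> e"
  shows "(\<integral>x. poly p (x k) * poly q (x j) \<partial>sphere_unif n)
    = (\<Sum>a\<le>d. \<Sum>b\<le>e. coeff p a * coeff q b * (sph_mom (real n + real b) a * sph_mom (real n) b))"
proof -
  have int: "integrable (sphere_unif n) (\<lambda>x. coeff p a * coeff q b * (x k ^ a * x j ^ b))" for a b
    using assms by (intro integrable_sphere_bounded sphere_bounded_intros) auto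
  have "poly p (x k) * poly q (x j) = (\<Sum>a\<le>d. \<Sum>b\<le>e. coeff p a * coeff q b * (x k ^ a * x j ^ b))" for x :: "nat \<Rightarrow> real"
    unfolding poly_altdef_le[OF assms(5)] poly_altdef_le[OF assms(6)] sum_product
    by (intro sum.cong refl) (simp only: mult_ac)
  hence "(\<integral>x. poly p (x k) * poly q (x j) \<partial>sphere_unif n)
     = (\<integral>x. (\<Sum>a\<le>d. \<Sum>b\<le>e. coeff p a * coeff q b * (x k ^ a * x j ^ b)) \<partial>sphere_unif n)" by simp
  also have "\<dots> = (\<Sum>a\<le>d. \<Sum>b\<le>e. \<integral>x. coeff p a * coeff q b * (x k ^ a * x j ^ b) \<partial>sphere_unif n)"
    using int by (subst Bochner_Integration.integral_sum) auto
  finally show ?thesis by (simp add: integral_mixed_moment[OF assms(1-4)])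
qed

text \<open>Moments of odd order in \<open>x_k\<close> vanish in every dimension, hence under every
  weight \<open>x_j^b\<close>; so \<open>q\<close> may be arbitrary.\<close>

lemma integral_poly_prod_odd:
  assumes "k < n" "j < n" "k \<noteq> j" "n \<ge> 3" "\<And>m. even m \<Longrightarrow> coeff p m = 0"
  shows "(\<integral>x. poly p (x k) * poly q (x j) \<partial>sphere_unif n) = 0"
  unfolding integral_poly_prod[OF assms(1-4) order_refl order_refl]
proof (intro sum.neutral ballI)
  fix a b
  show "coeff p a * coeff q b * (sph_mom (real n + real b) a * sph_mom (real n) b) = 0"
    using assms(5)[of a] sph_mom_odd[of a "real n + real b"] by (cases "even a") auto
qed

text \<open>In the monomial expansion the pair \<open>(a, b)\<close> contributes only through the
  difference of the \<open>a\<close>-th moments in dimensions \<open>n + b\<close> and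
  \<open>n\<close>, a relative error of at most \<open>a * b / n\<close>. As this factors, the
  double sum is the square of a single one, with weights \<open>m * fact m\<close>.\<close>

lemma integral_poly_prod_cov_bound:
  assumes "coeffs_bounded K n p" "degree p \<le> d" "k < n" "j < n" "k \<noteq> j" "n \<ge> 3" "K \<ge> 0"
  shows "\<bar>(\<integral>x. poly p (x k) * poly p (x j) \<partial>sphere_unif n)
      - (\<integral>x. poly p (x k) \<partial>sphere_unif n) * (\<integral>x. poly p (x j) \<partial>sphere_unif n)\<bar>
    \<le> (K * (\<Sum>m\<le>d. real m * fact m))\<^sup>2 / real n"
proof -
  have cov: "(\<integral>x. poly p (x k) * poly p (x j) \<partial>sphere_unif n)
      - (\<integral>x. poly p (x k) \<partial>sphere_unif n) * (\<integral>x. poly p (x j) \<partial>sphere_unif n)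
     = (\<Sum>a\<le>d. \<Sum>b\<le>d. coeff p a * coeff p b * (sph_mom (real n + real b) a * sph_mom (real n) b)
         - coeff p a * sph_mom (real n) a * (coeff p b * sph_mom (real n) b))" (is "_ = ?B")
    unfolding integral_poly_prod[OF assms(3-6,2,2)] integral_poly_coord[OF assms(3,6,2)]
      integral_poly_coord[OF assms(4,6,2)] sum_product sum_subtractf ..
  have "\<bar>?B\<bar> \<le> (\<Sum>a\<le>d. \<Sum>b\<le>d. (K * (real a * fact a)) * (K * (real b * fact b)) / real n)"
  proof (intro abs_sum_atMost_le)
    fix a b :: nat
    let ?u = "sph_mom (real n) a" and ?v = "sph_mom (real n) b"
    have "?u \<ge> 0" by (rule sph_mom_nonneg) simp
    hence 1: "\<bar>sph_mom (real n + real b) a - ?u\<bar> \<le> real a * real b / real n * \<bar>?u\<bar>"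
      using sph_mom_shift_bounds[of "real n" b a] assms(6) by (auto simp: algebra_simps)
    have "\<bar>coeff p a * coeff p b * (sph_mom (real n + real b) a * ?v) - coeff p a * ?u * (coeff p b * ?v)\<bar>
       = \<bar>sph_mom (real n + real b) a - ?u\<bar> * (\<bar>coeff p a\<bar> * \<bar>coeff p b * ?v\<bar>)"
      unfolding abs_mult[symmetric] by (rule arg_cong[where f=abs]) (simp add: algebra_simps)
    also have "\<dots> \<le> (real a * real b / real n * \<bar>?u\<bar>) * (\<bar>coeff p a\<bar> * \<bar>coeff p b * ?v\<bar>)"
      using 1 by (intro mult_right_mono) auto
    also have "\<dots> = (real a * real b / real n) * (\<bar>coeff p a * ?u\<bar> * \<bar>coeff p b * ?v\<bar>)"
      by (simp add: abs_mult)
    also have "\<dots> \<le> (real a * real b / real n) * ((K * fact a) * (K * fact b))"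
      using assms coeff_moment_bound[OF assms(1,6,7)] by (intro mult_left_mono mult_mono) auto
    finally show "\<bar>coeff p a * coeff p b * (sph_mom (real n + real b) a * ?v) - coeff p a * ?u * (coeff p b * ?v)\<bar>
      \<le> (K * (real a * fact a)) * (K * (real b * fact b)) / real n" by (simp add: algebra_simps)
  qed
  also have "\<dots> = (K * (\<Sum>m\<le>d. real m * fact m))\<^sup>2 / real n"
    unfolding power2_eq_square sum_distrib_left[of K "\<lambda>m. real m * fact m"]
    by (simp only: sum_product sum_divide_distrib)
  finally show ?thesis unfolding cov .
qed

section \<open>The normalised zonal polynomial\<close>

definition zonal_poly :: "nat \<Rightarrow> nat \<Rightarrow> real poly" where
  "zonal_poly n l = smult (harm_const n l) (geg_poly ((real n - 2) / 2) l)"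

lemma zonal_eq_poly: "n \<ge> 3 \<Longrightarrow> zonal n l k x = poly (zonal_poly n l) (x k)"
  by (simp add: zonal_def zonal_poly_def poly_geg_poly)

lemma degree_zonal_poly: "degree (zonal_poly n l) \<le> l"
  unfolding zonal_poly_def using degree_geg_poly order_trans[OF degree_smult_le] by blast

lemma zonal_poly_parity: "even (l + m) \<or> coeff (zonal_poly n l) m = 0"
  by (auto simp: zonal_poly_def coeff_geg_poly geg_coeff_def)

lemma zonal_poly_ode:
  fixes n l :: nat and t :: real
  defines "f \<equiv> pderiv (zonal_poly n l)"
  shows "(1 - t\<^sup>2) * poly (pderiv f) t - (real n - 1) * t * poly f t
    = - (real l * (real n + real l - 2)) * poly (zonal_poly n l) t"
proof -
  define \<kappa> A where "\<kappa> = (real n - 2) / 2" and "A = harm_const n l"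
  have f: "f = smult A (pderiv (geg_poly \<kappa> l))" "pderiv f = smult A (pderiv (pderiv (geg_poly \<kappa> l)))"
    by (simp_all add: f_def zonal_poly_def pderiv_smult A_def \<kappa>_def)
  have k2: "2 * \<kappa> = real n - 2" by (metis \<kappa>_def nonzero_mult_div_cancel_left times_divide_eq_right zero_neq_numeral)
  have k: "real n - 1 = 2 * \<kappa> + 1" "real n + real l - 2 = real l + 2 * \<kappa>" by (simp_all add: k2)
  have "(1 - t\<^sup>2) * poly (pderiv f) t - (real n - 1) * t * poly f t
     = A * ((1 - t\<^sup>2) * poly (pderiv (pderiv (geg_poly \<kappa> l))) t - (2 * \<kappa> + 1) * t * poly (pderiv (geg_poly \<kappa> l)) t)"
    unfolding k(1) f(1) f(2) pderiv_smult by (simp add: algebra_simps)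
  also have "\<dots> = A * (- (real l * (real l + 2 * \<kappa>)) * poly (geg_poly \<kappa> l) t)"
    unfolding geg_poly_ode ..
  finally show ?thesis unfolding k(2) by (simp add: zonal_poly_def A_def \<kappa>_def)
qed

lemma integral_zonal_poly_squared:
  assumes "k < n" "n \<ge> 3"
  shows "(\<integral>x. (poly (zonal_poly n l) (x k))\<^sup>2 \<partial>sphere_unif n) = 1"
proof -
  have "(harm_const n l)\<^sup>2 = fact (n - 3) * fact l * (real n + 2 * real l - 2) / (fact (n + l - 3) * (real n - 2))"
    unfolding harm_const_def using assms by (intro real_sqrt_pow2) auto
  moreover have "real n + 2 * real l - 2 > 0" "real n - 2 > 0" using assms by auto
  ultimately show ?thesis
    using integral_geg_poly_squared[OF assms, of l]
    by (simp add: zonal_poly_def power_mult_distrib)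
qed

text \<open>The quotient \<open>(n + l - 3)! / (n - 3)!\<close> has \<open>l\<close> factors, each
  at least \<open>n / 3\<close>, so the constant is of order \<open>n^(- l / 2)\<close>. Both
  \<open>3 ^ l\<close> and \<open>2 * l + 1\<close>, the largest value of
  \<open>(n + 2 l - 2) / (n - 2)\<close>, are dictated by the case \<open>n = 3\<close>.\<close>

lemma harm_const_bound:
  assumes "n \<ge> 3"
  shows "harm_const n l * sqrt (real n) ^ l \<le> sqrt (fact l * (2 * real l + 1) * 3 ^ l)"
proof -
  have "fact (n - 3) * (real n / 3) ^ l \<le> fact (n + l - 3)"
  proof (induction l)
    case (Suc l)
    have "fact (n - 3) * (real n / 3) ^ Suc l = (fact (n - 3) * (real n / 3) ^ l) * (real n / 3)" by simp
    also have "\<dots> \<le> fact (n + l - 3) * real (n + l - 2)"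
      using Suc assms by (intro mult_mono) (auto simp: of_nat_diff)
    also have "\<dots> = fact (n + Suc l - 3)"
    proof -
      have "n + Suc l - 3 = Suc (n + l - 3)" "Suc (n + l - 3) = n + l - 2" using assms by auto
      thus ?thesis by (metis fact_Suc mult.commute of_nat_fact of_nat_mult)
    qed
    finally show ?case .
  qed simp
  hence 1: "fact (n - 3) * real n ^ l \<le> 3 ^ l * fact (n + l - 3)"
    by (simp add: power_divide field_simps)
  have 2: "real n + 2 * real l - 2 \<le> (2 * real l + 1) * (real n - 2)"
  proof -
    have "0 \<le> 2 * real l * (real n - 3)" using assms by simp
    thus ?thesis by (simp add: algebra_simps)
  qed
  have pos: "real n - 2 > 0" "real n + 2 * real l - 2 > 0" using assms by auto
  have "(fact (n - 3) * real n ^ l) * (fact l * (real n + 2 * real l - 2))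
      \<le> (3 ^ l * fact (n + l - 3)) * (fact l * ((2 * real l + 1) * (real n - 2)))"
    by (intro mult_mono 1 2 order_refl) (use pos in auto)
  hence "fact (n - 3) * fact l * (real n + 2 * real l - 2) / (fact (n + l - 3) * (real n - 2)) * real n ^ l
     \<le> fact l * (2 * real l + 1) * 3 ^ l"
    using pos by (simp add: field_simps)
  from real_sqrt_le_mono[OF this] show ?thesis
    unfolding harm_const_def by (simp only: real_sqrt_mult real_sqrt_power)
qed

text \<open>The Pochhammer symbol in the \<open>m\<close>-th coefficient has
  \<open>(l + m) / 2\<close> factors, each at most \<open>(1 + l) * n\<close>. The normalising
  constant takes away \<open>n^(l / 2)\<close>, and the natural scale \<open>n^(m / 2)\<close>
  remains.\<close>

lemma coeffs_bounded_zonal_poly: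
  obtains K where "K \<ge> 0" "\<And>n. n \<ge> 3 \<Longrightarrow> coeffs_bounded K n (zonal_poly n l)"
proof -
  define H where "H = sqrt (fact l * (2 * real l + 1) * 3 ^ l)"
  define K where "K = H * (2 ^ l * (1 + real l) ^ l)"
  have "H \<ge> 0" by (simp add: H_def)
  hence K: "K \<ge> 0" by (simp add: K_def)
  have "\<bar>coeff (zonal_poly n l) m\<bar> \<le> K * sqrt (real n) ^ m" if n: "n \<ge> 3" for n m
  proof (cases "m \<le> l \<and> even (l - m)")
    case True
    define \<kappa> h where "\<kappa> = (real n - 2) / 2" and "h = (l + m) div 2"
    have k: "\<kappa> > 0" using n by (simp add: \<kappa>_def)
    have h: "2 * h = l + m" "h \<le> l" using True by (auto simp: h_def)
    have poch: "pochhammer \<kappa> h \<le> (1 + real l) ^ l * real n ^ h"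
    proof -
      have "pochhammer \<kappa> h \<le> (\<Prod>i<h. (1 + real l) * real n)"
        unfolding pochhammer_prod atLeast0LessThan
      proof (intro prod_mono conjI)
        fix i assume i: "i \<in> {..<h}"
        show "0 \<le> \<kappa> + of_nat i" using k by simp
        have "\<kappa> + real i \<le> real n + real l * 1" using i h n by (auto simp: \<kappa>_def field_simps)
        also have "\<dots> \<le> real n + real l * real n" using n by (intro add_left_mono mult_left_mono) auto
        finally show "\<kappa> + of_nat i \<le> (1 + real l) * real n" by (simp add: algebra_simps)
      qed
      also have "\<dots> = (1 + real l) ^ h * real n ^ h" by (simp add: power_mult_distrib)
      also have "\<dots> \<le> (1 + real l) ^ l * real n ^ h" using h by (intro mult_right_mono power_increasing) auto
      finally show ?thesis .
    qed
    have p0: "pochhammer \<kappa> h \<ge> 0" using k by (intro less_imp_le pochhammer_pos)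
    have sq: "real n ^ h = sqrt (real n) ^ l * sqrt (real n) ^ m"
    proof -
      have "real n ^ h = (sqrt (real n) ^ 2) ^ h" by simp
      also have "\<dots> = sqrt (real n) ^ (l + m)" by (simp only: power_mult[symmetric] h)
      finally show ?thesis by (simp add: power_add)
    qed
    have "\<bar>geg_coeff \<kappa> l m\<bar> = 2 ^ m * pochhammer \<kappa> h / (fact ((l - m) div 2) * fact m)"
      unfolding geg_coeff_def if_P[OF True] using p0 by (simp add: h_def[symmetric] abs_mult)
    also have "\<dots> \<le> 2 ^ m * pochhammer \<kappa> h / 1"
      using p0 mult_mono[OF fact_ge_1[of "(l - m) div 2", where ?'a = real] fact_ge_1[of m, where ?'a = real]]
      by (intro divide_left_mono) auto
    also have "\<dots> \<le> 2 ^ l * ((1 + real l) ^ l * real n ^ h)"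
      unfolding div_by_1 using True poch p0 by (intro mult_mono power_increasing) auto
    finally have g: "\<bar>geg_coeff \<kappa> l m\<bar> \<le> 2 ^ l * ((1 + real l) ^ l * real n ^ h)" .
    have A0: "harm_const n l \<ge> 0" using n by (simp add: harm_const_def)
    have "\<bar>coeff (zonal_poly n l) m\<bar> = harm_const n l * \<bar>geg_coeff \<kappa> l m\<bar>"
      using A0 by (simp add: zonal_poly_def coeff_geg_poly abs_mult \<kappa>_def)
    also have "\<dots> \<le> harm_const n l * (2 ^ l * ((1 + real l) ^ l * real n ^ h))"
      using A0 g by (intro mult_left_mono)
    also have "\<dots> = (harm_const n l * sqrt (real n) ^ l) * (2 ^ l * (1 + real l) ^ l * sqrt (real n) ^ m)"
      unfolding sq by (simp only: mult_ac)
    also have "\<dots> \<le> H * (2 ^ l * (1 + real l) ^ l * sqrt (real n) ^ m)"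
      unfolding H_def using harm_const_bound[OF n] by (intro mult_right_mono) auto
    finally show ?thesis by (simp only: K_def mult.assoc)
  next
    case False
    hence "geg_coeff ((real n - 2) / 2) l m = 0" unfolding geg_coeff_def by (rule if_not_P)
    thus ?thesis using K by (simp add: zonal_poly_def coeff_geg_poly)
  qed
  thus ?thesis using that[OF K] unfolding coeffs_bounded_def by blast
qed

subsection \<open>Concentration of the squared gradient\<close>

lemma integral_abs_le_sqrt:
  assumes "n > 0" "sphere_bounded n F" "(\<integral>x. (F x)\<^sup>2 \<partial>sphere_unif n) \<le> C"
  shows "(\<integral>x. \<bar>F x\<bar> \<partial>sphere_unif n) \<le> sqrt C"
proof -
  interpret prob_space "sphere_unif n" by (rule prob_space_sphere_unif[OF assms(1)])
  have "(expectation (\<lambda>x. \<bar>F x\<bar>))\<^sup>2 \<le> expectation (\<lambda>x. \<bar>F x\<bar>\<^sup>2)"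
  proof -
    have i: "integrable (sphere_unif n) (\<lambda>x. \<bar>F x\<bar>)" "integrable (sphere_unif n) (\<lambda>x. \<bar>F x\<bar>\<^sup>2)"
      using assms(2) by (intro integrable_sphere_bounded[OF assms(1)] sphere_bounded_intros; simp)+
    show ?thesis using variance_eq[OF i] variance_positive[of "\<lambda>x. \<bar>F x\<bar>"] by linarith
  qed
  hence "(expectation (\<lambda>x. \<bar>F x\<bar>))\<^sup>2 \<le> C" using assms(3) by simp
  thus ?thesis by (rule real_le_rsqrt)
qed

lemma integral_sum_squared:
  assumes n: "n > 0" and F: "\<And>k. k < n \<Longrightarrow> sphere_bounded n (F k)"
  shows "(\<integral>x. (\<Sum>k<n. c k * F k x)\<^sup>2 \<partial>sphere_unif n)
    = (\<Sum>k<n. \<Sum>j<n. c k * c j * (\<integral>x. F k x * F j x \<partial>sphere_unif n))"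
proof -
  have int: "integrable (sphere_unif n) (\<lambda>x. c k * c j * (F k x * F j x))" if "k < n" "j < n" for k j
    using that F by (intro integrable_sphere_bounded[OF n] sphere_bounded_intros) auto
  have "(\<integral>x. (\<Sum>k<n. c k * F k x)\<^sup>2 \<partial>sphere_unif n) = (\<integral>x. (\<Sum>k<n. \<Sum>j<n. c k * c j * (F k x * F j x)) \<partial>sphere_unif n)"
    unfolding power2_eq_square sum_product by (simp only: mult_ac)
  also have "\<dots> = (\<Sum>k<n. \<Sum>j<n. \<integral>x. c k * c j * (F k x * F j x) \<partial>sphere_unif n)"
    using int by (subst Bochner_Integration.integral_sum) auto
  finally show ?thesis by simp
qed

text \<open>The lower bound is Cauchy-Schwarz against the constant 1 and lets errors of order
  \<open>1 / n\<close> be absorbed; the upper bound lets the sum be replaced by its larger square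
  root.\<close>

lemma sum_power4_bounds:
  fixes a :: "nat \<Rightarrow> real"
  assumes "n > 0" "(\<Sum>i<n. (a i)\<^sup>2) = 1"
  shows "1 / real n \<le> (\<Sum>i<n. (a i)^4)" "(\<Sum>i<n. (a i)^4) \<le> 1"
proof -
  have e: "(a i)^4 = ((a i)\<^sup>2)\<^sup>2" for i by simp
  have "(\<Sum>i<n. (a i)\<^sup>2 * 1)\<^sup>2 \<le> (\<Sum>i<n. ((a i)\<^sup>2)\<^sup>2) * (\<Sum>i<n. 1\<^sup>2)"
    by (rule Cauchy_Schwarz_ineq_sum)
  hence "1 \<le> (\<Sum>i<n. (a i)^4) * real n" using assms by (simp only: e) simp
  thus "1 / real n \<le> (\<Sum>i<n. (a i)^4)" using assms by (simp add: field_simps)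
  have "(a i)\<^sup>2 \<le> 1" if "i < n" for i
    using member_le_sum[of i "{..<n}" "\<lambda>i. (a i)\<^sup>2"] that assms by simp
  hence "(\<Sum>i<n. (a i)^4) \<le> (\<Sum>i<n. (a i)\<^sup>2 * 1)"
    unfolding e power2_eq_square[of "(a _)\<^sup>2"] by (intro sum_mono mult_left_mono) auto
  thus "(\<Sum>i<n. (a i)^4) \<le> 1" using assms by simp
qed

text \<open>The quantity splits as \<open>V^2 / \<mu> - U\<close>, where \<open>U\<close> averages
  the almost centred values \<open>q(x_k)\<close> with weights \<open>a_k^2\<close> and
  \<open>V\<close> is the sum of \<open>a_k T(x_k)\<close>. \<open>U\<close> needs a variance
  estimate. \<open>V\<close> enters as a square over \<open>\<mu>\<close>, so its bounded second
  moment already gives an error of order \<open>1 / n\<close>.\<close>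

lemma gradient_norm_concentration:
  assumes "odd l"
  obtains C where "C \<ge> 0"
    "\<And>n a. n \<ge> 3 \<Longrightarrow> (\<Sum>i<n. (a i)\<^sup>2) = 1 \<Longrightarrow>
      (\<integral>x. \<bar>1 - ((\<Sum>k<n. (a k)\<^sup>2 * (poly (pderiv (zonal_poly n l)) (x k))\<^sup>2)
           - (\<Sum>k<n. a k * x k * poly (pderiv (zonal_poly n l)) (x k))\<^sup>2) / (real l * (real n + real l - 2))\<bar> \<partial>sphere_unif n)
      \<le> C * sqrt (\<Sum>i<n. (a i)^4)"
proof -
  obtain K where K: "K \<ge> 0" "\<And>n. n \<ge> 3 \<Longrightarrow> coeffs_bounded K n (zonal_poly n l)"
    by (rule coeffs_bounded_zonal_poly[where l=l]) blast
  \<comment> \<open>All constants depend on \<open>l\<close> alone. \<open>L\<close> pays for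
    differentiation, \<open>L2\<close> and \<open>Q2\<close> for products, and
    \<open>d = 4 * l\<close> dominates every degree that occurs. The 2 in \<open>Q1\<close> and in
    \<open>2 * B\<close> is the loss in \<open>\<mu> \<ge> n / 2\<close>. \<open>B\<close> bounds
    the mean of \<open>T(x_k)^2\<close>; \<open>B2\<close> serves for the products
    \<open>q(x_k) q(x_j)\<close>, on the diagonal as it is and off it divided by
    \<open>n\<close>.\<close>
  define L where "L = real (l + 1) * K"
  define d where "d = 4 * l"
  define F where "F = (\<Sum>m\<le>d. fact m :: real)"
  define G where "G = (\<Sum>m\<le>d. real m * fact m :: real)"
  define L2 where "L2 = real (d + 1) * L * L"
  define Q1 where "Q1 = 2 * L2 + 1"
  define Q2 where "Q2 = real (d + 1) * Q1 * Q1"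
  define B where "B = L2 * F"
  define B2 where "B2 = Q2 * F + (Q1 * G)\<^sup>2 + (2 * B)\<^sup>2"
  have nonneg: "L \<ge> 0" "F \<ge> 0" "G \<ge> 0" "L2 \<ge> 0" "Q1 \<ge> 0" "Q2 \<ge> 0" "B \<ge> 0" "B2 \<ge> 0"
    using K by (auto simp: L_def F_def G_def L2_def Q1_def Q2_def B_def B2_def intro!: sum_nonneg add_nonneg_nonneg mult_nonneg_nonneg)
  have l: "l \<ge> 1" using assms by (cases l) auto
  have main: "(\<integral>x. \<bar>1 - ((\<Sum>k<n. (a k)\<^sup>2 * (poly (pderiv (zonal_poly n l)) (x k))\<^sup>2)
           - (\<Sum>k<n. a k * x k * poly (pderiv (zonal_poly n l)) (x k))\<^sup>2) / (real l * (real n + real l - 2))\<bar> \<partial>sphere_unif n)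
      \<le> (sqrt (2 * B2) + 2 * B) * sqrt (\<Sum>i<n. (a i)^4)"
    if n: "n \<ge> 3" and a: "(\<Sum>i<n. (a i)\<^sup>2) = 1" for n a
  proof -
    let ?S = "sphere_unif n"
    define \<phi> where "\<phi> = zonal_poly n l"
    define f where "f = pderiv \<phi>"
    define \<mu> where "\<mu> = real l * (real n + real l - 2)"
    define r where "r = sqrt (real n)"
    define S4 where "S4 = (\<Sum>i<n. (a i)^4)"
    have S4: "1 / real n \<le> S4" "S4 \<le> 1" "S4 \<ge> 0"
      using sum_power4_bounds[OF _ a] n by (auto simp: S4_def intro!: sum_nonneg)
    have r: "r > 0" "r * r = real n" using n by (auto simp: r_def)
    have n0: "n > 0" using n by simp
    interpret prob_space ?S by (rule prob_space_sphere_unif[OF n0])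
    have mu: "\<mu> \<ge> real n / 2"
    proof -
      have "real n / 2 \<le> 1 * (real n + real l - 2)" using n l by auto
      also have "\<dots> \<le> \<mu>" unfolding \<mu>_def using n l by (intro mult_right_mono) auto
      finally show ?thesis .
    qed
    have mu0: "\<mu> > 0" using mu n by linarith
    have c\<phi>: "\<bar>coeff \<phi> m\<bar> \<le> K * r ^ m" for m
      using K(2)[OF n] by (simp add: coeffs_bounded_def \<phi>_def r_def)
    have deg\<phi>: "degree \<phi> \<le> l" unfolding \<phi>_def by (rule degree_zonal_poly)
    \<comment> \<open>Differentiation lowers the degree but not the bound, so \<open>f\<close> sits
      one factor \<open>sqrt n\<close> above the natural scale. Multiplying by the variable, as in
      \<open>T\<close>, or dividing by \<open>r\<close> restores it; in \<open>q\<close> the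
      division of \<open>f * f\<close> by \<open>\<mu> \<ge> n / 2\<close> does so.\<close>
    have cf: "\<bar>coeff f m\<bar> \<le> L * r ^ Suc m" for m
    proof (cases "Suc m \<le> l")
      case True
      have "\<bar>coeff f m\<bar> = real (Suc m) * \<bar>coeff \<phi> (Suc m)\<bar>" by (simp add: f_def coeff_pderiv abs_mult)
      also have "\<dots> \<le> real (l + 1) * (K * r ^ Suc m)" using True c\<phi>[of "Suc m"] by (intro mult_mono) auto
      finally show ?thesis by (simp add: L_def mult.assoc)
    next
      case False
      hence "coeff f m = 0" using deg\<phi> by (simp add: f_def coeff_pderiv coeff_eq_0)
      thus ?thesis using nonneg r by simp
    qed
    have degf: "degree f \<le> l - 1" using deg\<phi> by (simp add: f_def degree_pderiv diff_le_mono)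
    define T where "T = pCons 0 f"
    have cT: "coeffs_bounded L n T"
      unfolding coeffs_bounded_def T_def
    proof
      fix m show "\<bar>coeff (pCons 0 f) m\<bar> \<le> L * sqrt (real n) ^ m"
        using cf nonneg r by (cases m) (auto simp: r_def)
    qed
    have degT: "degree T \<le> l" unfolding T_def using degf l by (intro degree_pCons_le[THEN order_trans]) auto
    have cTT: "coeffs_bounded L2 n (T * T)"
      unfolding L2_def using degT by (intro coeffs_bounded_mult cT nonneg) (auto simp: d_def intro!: order_trans[OF degree_mult_le])
    have degTT: "degree (T * T) \<le> d" using degT by (auto simp: d_def intro!: order_trans[OF degree_mult_le])
    have pTT: "poly (T * T) t = (t * poly f t)\<^sup>2" for t by (simp add: T_def power2_eq_square)
    have ET: "(\<integral>x. (x k * poly f (x k))\<^sup>2 \<partial>?S) \<le> B" if k: "k < n" for k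
      using integral_poly_coord_bound[OF cTT degTT k n nonneg(4)] unfolding pTT B_def F_def by linarith
    define q where "q = smult (1 / \<mu>) (f * f) - 1"
    have cq: "coeffs_bounded Q1 n q" unfolding coeffs_bounded_def
    proof
      fix m
      have "coeffs_bounded L n (smult (1 / r) f)" unfolding coeffs_bounded_def
      proof
        fix m
        have "\<bar>coeff f m\<bar> \<le> r * (L * r ^ m)" using cf[of m] by (simp add: mult_ac)
        thus "\<bar>coeff (smult (1 / r) f) m\<bar> \<le> L * sqrt (real n) ^ m"
          using r by (simp add: abs_mult r_def[symmetric] field_simps)
      qed
      hence "coeffs_bounded L2 n (smult (1 / r) f * smult (1 / r) f)"
        unfolding L2_def using degf by (intro coeffs_bounded_mult nonneg) (auto simp: d_def intro!: order_trans[OF degree_smult_le] order_trans[OF degree_mult_le])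
      hence 1: "\<bar>coeff (f * f) m\<bar> / real n \<le> L2 * r ^ m"
        unfolding coeffs_bounded_def using r by (simp add: r_def[symmetric] abs_mult mult.assoc[symmetric])
      have "\<bar>coeff (smult (1 / \<mu>) (f * f)) m\<bar> = \<bar>coeff (f * f) m\<bar> / \<mu>" using mu0 by (simp add: abs_mult)
      also have "\<dots> \<le> \<bar>coeff (f * f) m\<bar> / (real n / 2)" using mu mu0 n by (intro divide_left_mono) auto
      also have "\<dots> = 2 * (\<bar>coeff (f * f) m\<bar> / real n)" by simp
      also have "\<dots> \<le> 2 * (L2 * r ^ m)" using 1 by simp
      finally have 2: "\<bar>coeff (smult (1 / \<mu>) (f * f)) m\<bar> \<le> 2 * L2 * r ^ m" by simp
      have 3: "\<bar>coeff (1 :: real poly) m\<bar> \<le> r ^ m" using r by (cases m) auto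
      have "\<bar>coeff q m\<bar> \<le> \<bar>coeff (smult (1 / \<mu>) (f * f)) m\<bar> + \<bar>coeff (1 :: real poly) m\<bar>"
        unfolding q_def coeff_diff by (rule abs_triangle_ineq4)
      thus "\<bar>coeff q m\<bar> \<le> Q1 * sqrt (real n) ^ m"
        using 2 3 by (simp add: Q1_def r_def algebra_simps)
    qed
    have degq: "degree q \<le> 2 * l" unfolding q_def using degf
      by (intro degree_diff_le) (auto intro!: order_trans[OF degree_smult_le] order_trans[OF degree_mult_le])
    have degq': "degree q \<le> d" "degree (q * q) \<le> d" using degq by (auto simp: d_def intro!: order_trans[OF degree_mult_le])
    have cqq: "coeffs_bounded Q2 n (q * q)" unfolding Q2_def by (intro coeffs_bounded_mult cq degq' nonneg)
    have pq: "poly q t = (poly f t)\<^sup>2 / \<mu> - 1" for t by (simp add: q_def power2_eq_square)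
    note nice = sphere_bounded_intros
    have int: "integrable ?S (\<lambda>x. (poly f (x k))\<^sup>2)" "integrable ?S (\<lambda>x. (x k * poly f (x k))\<^sup>2)" if "k < n" for k
      using that by (intro integrable_sphere_bounded[OF n0] nice; simp)+
    \<comment> \<open>Unit norm of \<open>\<phi>\<close> and the Dirichlet form give that
      \<open>f^2\<close> has mean \<open>\<mu>\<close> plus the mean of \<open>T^2\<close>. So the
      mean of \<open>q\<close> is exactly that of \<open>T^2\<close> divided by
      \<open>\<mu>\<close>, which is of order \<open>1 / n\<close>.\<close>
    have Eq: "\<bar>\<integral>x. poly q (x k) \<partial>?S\<bar> \<le> 2 * B / real n" if k: "k < n" for k
    proof -
      have "\<mu> * (\<integral>x. (poly \<phi> (x k))\<^sup>2 \<partial>?S) = (\<integral>x. (1 - (x k)\<^sup>2) * (poly f (x k))\<^sup>2 \<partial>?S)"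
        unfolding f_def \<phi>_def \<mu>_def by (intro integral_dirichlet_form k n zonal_poly_ode)
      hence "\<mu> = (\<integral>x. (poly f (x k))\<^sup>2 - (x k * poly f (x k))\<^sup>2 \<partial>?S)"
        using integral_zonal_poly_squared[OF k n] by (simp add: \<phi>_def algebra_simps power_mult_distrib)
      also have "\<dots> = (\<integral>x. (poly f (x k))\<^sup>2 \<partial>?S) - (\<integral>x. (x k * poly f (x k))\<^sup>2 \<partial>?S)"
        using int[OF k] by (rule Bochner_Integration.integral_diff)
      finally have e: "(\<integral>x. (poly f (x k))\<^sup>2 \<partial>?S) = \<mu> + (\<integral>x. (x k * poly f (x k))\<^sup>2 \<partial>?S)" by simp
      have "(\<integral>x. poly q (x k) \<partial>?S) = (\<integral>x. (poly f (x k))\<^sup>2 \<partial>?S) / \<mu> - 1"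
        unfolding pq using int[OF k] prob_space by (simp del: sphere_unif_simps)
      also have "\<dots> = (\<integral>x. (x k * poly f (x k))\<^sup>2 \<partial>?S) / \<mu>" unfolding e using mu0 by (simp add: field_simps)
      finally have e2: "(\<integral>x. poly q (x k) \<partial>?S) = (\<integral>x. (x k * poly f (x k))\<^sup>2 \<partial>?S) / \<mu>" .
      have p: "0 \<le> (\<integral>x. (x k * poly f (x k))\<^sup>2 \<partial>?S)" by (intro integral_nonneg_AE) auto
      have "(\<integral>x. (x k * poly f (x k))\<^sup>2 \<partial>?S) / \<mu> \<le> B / (real n / 2)"
        using ET[OF k] mu n p nonneg by (intro frac_le) auto
      thus ?thesis unfolding e2 using p mu0 by (simp add: mult.commute)
    qed
    have n1: "1 / real n \<le> 1" using n by simp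
    have Eqq: "\<bar>\<integral>x. poly q (x k) * poly q (x j) \<partial>?S\<bar> \<le> (if k = j then B2 else B2 / real n)" if k: "k < n" and j: "j < n" for k j
    proof (cases "k = j")
      case True
      have "\<bar>\<integral>x. poly q (x k) * poly q (x k) \<partial>?S\<bar> \<le> Q2 * F"
        using integral_poly_coord_bound[OF cqq degq'(2) k n nonneg(6)] by (simp add: F_def)
      also have "\<dots> \<le> B2" unfolding B2_def by simp
      finally show ?thesis using True by simp
    next
      case False
      have c: "\<bar>(\<integral>x. poly q (x k) * poly q (x j) \<partial>?S) - (\<integral>x. poly q (x k) \<partial>?S) * (\<integral>x. poly q (x j) \<partial>?S)\<bar> \<le> (Q1 * G)\<^sup>2 / real n"
        unfolding G_def by (intro integral_poly_prod_cov_bound cq degq' k j n False nonneg)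
      have "\<bar>(\<integral>x. poly q (x k) \<partial>?S) * (\<integral>x. poly q (x j) \<partial>?S)\<bar> \<le> (2 * B / real n) * (2 * B / real n)"
        unfolding abs_mult using Eq[OF k] Eq[OF j] nonneg by (intro mult_mono) auto
      also have "\<dots> = (2 * B)\<^sup>2 / real n * (1 / real n)" by (simp add: power2_eq_square)
      also have "\<dots> \<le> (2 * B)\<^sup>2 / real n * 1" using n1 by (intro mult_left_mono) auto
      finally have "\<bar>\<integral>x. poly q (x k) * poly q (x j) \<partial>?S\<bar> \<le> (Q1 * G)\<^sup>2 / real n + (2 * B)\<^sup>2 / real n"
        using c by linarith
      also have "\<dots> \<le> B2 / real n" unfolding add_divide_distrib[symmetric] B2_def using nonneg by (intro divide_right_mono) auto
      finally show ?thesis using False by simp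
    qed
    define U where "U x = (\<Sum>k<n. (a k)\<^sup>2 * poly q (x k))" for x :: "nat \<Rightarrow> real"
    define V where "V x = (\<Sum>k<n. a k * poly T (x k))" for x :: "nat \<Rightarrow> real"
    have U: "sphere_bounded n U" unfolding U_def by (intro nice) auto
    have V: "sphere_bounded n V" unfolding V_def by (intro nice) auto
    have "(\<integral>x. (U x)\<^sup>2 \<partial>?S) = (\<Sum>k<n. \<Sum>j<n. (a k)\<^sup>2 * (a j)\<^sup>2 * (\<integral>x. poly q (x k) * poly q (x j) \<partial>?S))"
      unfolding U_def by (rule integral_sum_squared[OF n0]) (intro nice)
    \<comment> \<open>The diagonal yields \<open>\<Sum> a_k^4\<close>. Adding \<open>B2 / n\<close>
      there as well costs nothing in order and makes the remaining double sum a product, equal to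
      \<open>B2 / n\<close> because the \<open>a_k^2\<close> sum to 1.\<close>
    also have "\<dots> \<le> (\<Sum>k<n. \<Sum>j<n. (if k = j then (a k)\<^sup>2 * (a j)\<^sup>2 * B2 else 0) + (a k)\<^sup>2 * (a j)\<^sup>2 * (B2 / real n))"
    proof (intro sum_mono)
      fix k j assume kj: "k \<in> {..<n}" "j \<in> {..<n}"
      have "(\<integral>x. poly q (x k) * poly q (x j) \<partial>?S) \<le> (if k = j then B2 else 0) + B2 / real n"
        using Eqq[of k j] kj nonneg by (auto split: if_splits intro: order_trans)
      hence "(a k)\<^sup>2 * (a j)\<^sup>2 * (\<integral>x. poly q (x k) * poly q (x j) \<partial>?S) \<le> (a k)\<^sup>2 * (a j)\<^sup>2 * ((if k = j then B2 else 0) + B2 / real n)"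
        by (intro mult_left_mono) auto
      thus "(a k)\<^sup>2 * (a j)\<^sup>2 * (\<integral>x. poly q (x k) * poly q (x j) \<partial>?S)
         \<le> (if k = j then (a k)\<^sup>2 * (a j)\<^sup>2 * B2 else 0) + (a k)\<^sup>2 * (a j)\<^sup>2 * (B2 / real n)"
        by (simp add: distrib_left split: if_splits)
    qed
    also have "\<dots> = B2 * S4 + (\<Sum>k<n. (a k)\<^sup>2) * (\<Sum>j<n. (a j)\<^sup>2) * (B2 / real n)"
    proof -
      have "(\<Sum>k<n. \<Sum>j<n. (if k = j then (a k)\<^sup>2 * (a j)\<^sup>2 * B2 else 0)) = (\<Sum>k<n. (a k)\<^sup>2 * (a k)\<^sup>2 * B2)"
        by (intro sum.cong refl) (simp add: sum.delta)
      also have "\<dots> = B2 * S4" unfolding S4_def sum_distrib_left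
        by (intro sum.cong refl) (simp add: power4_eq_xxxx power2_eq_square)
      finally show ?thesis unfolding sum.distrib sum_product by (simp only: sum_distrib_right)
    qed
    also have "\<dots> = B2 * S4 + B2 * (1 / real n)" by (simp add: a)
    also have "\<dots> \<le> 2 * B2 * S4" using mult_left_mono[OF S4(1) nonneg(8)] by simp
    finally have EU: "(\<integral>x. \<bar>U x\<bar> \<partial>?S) \<le> sqrt (2 * B2 * S4)" by (intro integral_abs_le_sqrt[OF n0 U])
    \<comment> \<open>Here oddness of \<open>l\<close> enters: \<open>\<phi>\<close> is odd, its
      derivative even, and \<open>T\<close> odd again, so the cross terms in the second moment of
      \<open>V\<close> vanish.\<close>
    have par: "coeff T m = 0" if "even m" for m
    proof (cases m)
      case (Suc i)
      hence "odd (l + Suc i) " using that assms by auto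
      hence "coeff \<phi> (Suc i) = 0" using zonal_poly_parity[of l "Suc i" n] by (simp add: \<phi>_def)
      thus ?thesis using Suc by (simp add: T_def f_def coeff_pderiv)
    qed (simp add: T_def)
    have "(\<integral>x. (V x)\<^sup>2 \<partial>?S) = (\<Sum>k<n. \<Sum>j<n. a k * a j * (\<integral>x. poly T (x k) * poly T (x j) \<partial>?S))"
      unfolding V_def by (rule integral_sum_squared[OF n0]) (intro nice)
    also have "\<dots> = (\<Sum>k<n. (a k)\<^sup>2 * (\<integral>x. (x k * poly f (x k))\<^sup>2 \<partial>?S))"
    proof (intro sum.cong refl)
      fix k assume k: "k \<in> {..<n}"
      have "(\<Sum>j<n. a k * a j * (\<integral>x. poly T (x k) * poly T (x j) \<partial>?S))
         = (\<Sum>j<n. if k = j then a k * a j * (\<integral>x. poly T (x k) * poly T (x j) \<partial>?S) else 0)"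
        using k n par by (intro sum.cong refl) (auto simp: integral_poly_prod_odd)
      also have "\<dots> = a k * a k * (\<integral>x. poly T (x k) * poly T (x k) \<partial>?S)" using k by (simp add: sum.delta)
      finally show "(\<Sum>j<n. a k * a j * (\<integral>x. poly T (x k) * poly T (x j) \<partial>?S)) = (a k)\<^sup>2 * (\<integral>x. (x k * poly f (x k))\<^sup>2 \<partial>?S)"
        by (simp add: T_def power2_eq_square)
    qed
    also have "\<dots> \<le> (\<Sum>k<n. (a k)\<^sup>2 * B)" using ET by (intro sum_mono mult_left_mono) auto
    also have "\<dots> = B" by (simp add: sum_distrib_right[symmetric] a)
    finally have EV: "(\<integral>x. (V x)\<^sup>2 \<partial>?S) \<le> B" .
    \<comment> \<open>The 1 is distributed as \<open>\<Sum> a_k^2\<close>, which centres each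
      \<open>f(x_k)^2 / \<mu>\<close> separately.\<close>
    have eq: "1 - ((\<Sum>k<n. (a k)\<^sup>2 * (poly f (x k))\<^sup>2) - (\<Sum>k<n. a k * x k * poly f (x k))\<^sup>2) / \<mu> = (V x)\<^sup>2 / \<mu> - U x" for x
    proof -
      have "U x = (\<Sum>k<n. (a k)\<^sup>2 * (poly f (x k))\<^sup>2 / \<mu> - (a k)\<^sup>2)" unfolding U_def pq by (simp add: right_diff_distrib)
      also have "\<dots> = (\<Sum>k<n. (a k)\<^sup>2 * (poly f (x k))\<^sup>2) / \<mu> - 1" by (simp add: sum_subtractf a sum_divide_distrib)
      finally have U': "U x = (\<Sum>k<n. (a k)\<^sup>2 * (poly f (x k))\<^sup>2) / \<mu> - 1" .
      have "V x = (\<Sum>k<n. a k * x k * poly f (x k))" by (simp add: V_def T_def mult.assoc)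
      thus ?thesis unfolding U' by (simp add: diff_divide_distrib)
    qed
    have iU: "integrable ?S (\<lambda>x. \<bar>U x\<bar>)" using U by (intro integrable_sphere_bounded[OF n0] nice)
    have iV: "integrable ?S (\<lambda>x. (V x)\<^sup>2 / \<mu>)" using V by (intro integrable_sphere_bounded[OF n0] nice)
    have iD: "integrable ?S (\<lambda>x. \<bar>(V x)\<^sup>2 / \<mu> - U x\<bar>)" using U V by (intro integrable_sphere_bounded[OF n0] nice)
    have "(\<integral>x. \<bar>(V x)\<^sup>2 / \<mu> - U x\<bar> \<partial>?S) \<le> (\<integral>x. (V x)\<^sup>2 / \<mu> + \<bar>U x\<bar> \<partial>?S)"
    proof (rule integral_mono)
      fix x
      have "\<bar>(V x)\<^sup>2 / \<mu> - U x\<bar> \<le> \<bar>(V x)\<^sup>2 / \<mu>\<bar> + \<bar>U x\<bar>" by (rule abs_triangle_ineq4)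
      thus "\<bar>(V x)\<^sup>2 / \<mu> - U x\<bar> \<le> (V x)\<^sup>2 / \<mu> + \<bar>U x\<bar>" using mu0 by simp
    qed (use iU iV iD in auto)
    also have "\<dots> = (\<integral>x. (V x)\<^sup>2 \<partial>?S) / \<mu> + (\<integral>x. \<bar>U x\<bar> \<partial>?S)" using iU iV by simp
    also have "\<dots> \<le> 2 * B * sqrt S4 + sqrt (2 * B2 * S4)"
    proof (intro add_mono EU)
      have s: "0 \<le> (\<integral>x. (V x)\<^sup>2 \<partial>?S)" by (intro integral_nonneg_AE) auto
      have "(\<integral>x. (V x)\<^sup>2 \<partial>?S) / \<mu> \<le> B / (real n / 2)" using EV mu n s nonneg by (intro frac_le) auto
      also have "\<dots> = 2 * B * (1 / real n)" by simp
      also have "\<dots> \<le> 2 * B * S4" using S4 nonneg by (intro mult_left_mono) auto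
      also have "\<dots> \<le> 2 * B * sqrt S4"
      proof (intro mult_left_mono)
        have "S4 * S4 \<le> S4 * 1" using S4 by (intro mult_left_mono) auto
        thus "S4 \<le> sqrt S4" using S4 by (intro real_le_rsqrt) (simp add: power2_eq_square)
      qed (use nonneg in auto)
      finally show "(\<integral>x. (V x)\<^sup>2 \<partial>?S) / \<mu> \<le> 2 * B * sqrt S4" .
    qed
    finally have fin: "(\<integral>x. \<bar>(V x)\<^sup>2 / \<mu> - U x\<bar> \<partial>?S) \<le> (sqrt (2 * B2) + 2 * B) * sqrt S4"
      by (simp add: algebra_simps real_sqrt_mult)
    show ?thesis
      unfolding \<phi>_def[symmetric] f_def[symmetric] \<mu>_def[symmetric] S4_def[symmetric] eq by (rule fin)
  qed
  show ?thesis by (rule that[OF _ main]) (use nonneg in auto)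
qed

subsection \<open>Stein's equation for the normal law\<close>

lemma nn_integral_gaussian_tail:
  assumes "x \<ge> 0"
  shows "(\<integral>\<^sup>+t. ennreal (t * std_normal_density t) * indicator {x..} t \<partial>lborel) = ennreal (std_normal_density x)"
proof -
  have "(\<integral>\<^sup>+t. ennreal (t * std_normal_density t) * indicator {x..} t \<partial>lborel) = ennreal (0 - (- std_normal_density x))"
  proof (rule nn_integral_FTC_atLeast)
    fix t :: real assume "x \<le> t"
    show "((\<lambda>t. - std_normal_density t) has_real_derivative t * std_normal_density t) (at t)"
      unfolding std_normal_density_def by (auto intro!: derivative_eq_intros simp: field_simps)
    show "0 \<le> t * std_normal_density t" using \<open>x \<le> t\<close> assms by simp
  next
    have "filterlim (\<lambda>t::real. 1 / 2 * t\<^sup>2) at_top at_top"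
      by (rule filterlim_tendsto_pos_mult_at_top[OF tendsto_const _ filterlim_pow_at_top[OF _ filterlim_ident]]) auto
    hence "filterlim (\<lambda>t::real. - t\<^sup>2 / 2) at_bot at_top" by (simp add: filterlim_uminus_at_bot)
    hence "((\<lambda>t::real. exp (- t\<^sup>2 / 2)) \<longlongrightarrow> 0) at_top" by (rule filterlim_compose[OF exp_at_bot])
    from tendsto_minus[OF tendsto_mult_left[OF this, of "1 / sqrt (2 * pi)"]]
    show "((\<lambda>t. - std_normal_density t) \<longlongrightarrow> 0) at_top"
      unfolding std_normal_density_def by simp
  qed measurable
  thus ?thesis by simp
qed

text \<open>On the tail \<open>x \<le> t\<close>, so \<open>x\<close> may be replaced by
  \<open>t\<close> under the integral; \<open>t\<close> times the density has minus the density as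
  an antiderivative.\<close>

lemma gaussian_tail_mills:
  assumes "x \<ge> 0"
  shows "x * (\<integral>t. indicator {x..} t * std_normal_density t \<partial>lborel) \<le> std_normal_density x"
proof -
  have [simp]: "integrable lborel (\<lambda>t. indicator {x..} t * std_normal_density t)"
    using integrable_real_mult_indicator[of "{x..}" lborel std_normal_density] by (simp add: mult.commute)
  have "ennreal (x * (\<integral>t. indicator {x..} t * std_normal_density t \<partial>lborel))
      = ennreal (\<integral>t. x * (indicator {x..} t * std_normal_density t) \<partial>lborel)" by simp
  also have "\<dots> = (\<integral>\<^sup>+t. ennreal (x * (indicator {x..} t * std_normal_density t)) \<partial>lborel)"
    using assms by (intro nn_integral_eq_integral[symmetric]) auto
  also have "\<dots> \<le> (\<integral>\<^sup>+t. ennreal (t * std_normal_density t) * indicator {x..} t \<partial>lborel)"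
    by (intro nn_integral_mono) (auto simp: indicator_def intro!: ennreal_leI mult_right_mono)
  also have "\<dots> = ennreal (std_normal_density x)" by (rule nn_integral_gaussian_tail[OF assms])
  finally show ?thesis by simp
qed

text \<open>The solution is \<open>g = H / \<rho>\<close> with \<open>\<rho>\<close> the normal
  density and \<open>H\<close> the integral of \<open>(h - m) \<rho>\<close> up to \<open>x\<close>.
  The Mills bound gives \<open>\<bar>x * g x\<bar> \<le> 1\<close>; together with
  \<open>\<bar>h - m\<bar> \<le> 1\<close> this is the constant 2, uniformly over test functions
  with values between 0 and 1.\<close>

lemma stein_equation:
  fixes h :: "real \<Rightarrow> real"
  assumes h: "continuous_on UNIV h" "\<And>x. 0 \<le> h x" "\<And>x. h x \<le> 1"
  obtains g g' where "\<And>y. (g has_real_derivative g' y) (at y)" "continuous_on UNIV g'" "\<And>y. \<bar>g' y\<bar> \<le> 2"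
    "\<And>y. g' y - y * g y = h y - (\<integral>z. h z \<partial>std_normal_distribution)"
proof -
  let ?N = std_normal_distribution and ?\<rho> = std_normal_density
  interpret N: prob_space ?N by (rule prob_space_normal_density) simp
  note [measurable] = borel_measurable_continuous_onI[OF h(1)]
  define m where "m = (\<integral>z. h z \<partial>?N)"
  have hint: "integrable ?N h" by (rule N.integrable_const_bound[where B=1]) (use h in auto)
  have "0 \<le> m" unfolding m_def by (intro integral_nonneg_AE) (use h in auto)
  moreover have "m \<le> 1" unfolding m_def by (rule N.integral_le_const[OF hint]) (use h in auto)
  ultimately have hm: "\<bar>h x - m\<bar> \<le> 1" for x using h(2,3)[of x] by auto
  define \<psi> where "\<psi> = (\<lambda>t. (h t - m) * ?\<rho> t)"
  have \<rho>c: "continuous_on UNIV ?\<rho>" unfolding std_normal_density_def by (intro continuous_intros) auto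
  have \<psi>c: "continuous_on UNIV \<psi>" unfolding \<psi>_def by (intro continuous_intros h \<rho>c)
  have [measurable]: "\<psi> \<in> borel_measurable borel" by (rule borel_measurable_continuous_onI[OF \<psi>c])
  have \<psi>le: "\<bar>\<psi> t\<bar> \<le> ?\<rho> t" for t
    unfolding \<psi>_def abs_mult using mult_right_mono[OF hm, of "?\<rho> t"] by simp
  have \<psi>int: "integrable lborel \<psi>"
    by (rule Bochner_Integration.integrable_bound[of lborel ?\<rho>]) (use \<psi>le in auto)
  have \<psi>0: "(\<integral>t. \<psi> t \<partial>lborel) = 0"
  proof -
    have "(\<integral>t. \<psi> t \<partial>lborel) = (\<integral>z. h z - m \<partial>?N)"
      by (subst integral_density) (auto simp: \<psi>_def mult.commute)
    also have "\<dots> = 0" using hint N.prob_space by (simp add: m_def)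
    finally show ?thesis .
  qed
  have ind: "integrable lborel (\<lambda>t. indicator A t * f t)" if "A \<in> sets borel" "integrable lborel f" for A and f :: "real \<Rightarrow> real"
    using integrable_real_mult_indicator[of A lborel f] that by (simp add: mult.commute)
  define H where "H x = (\<integral>t. indicator {..x} t * \<psi> t \<partial>lborel)" for x
  have H: "(H has_real_derivative \<psi> x) (at x)" for x
  proof -
    \<comment> \<open>Near \<open>x\<close> the improper integral differs by the constant
      \<open>H a\<close> from one over a compact interval, where the fundamental theorem of calculus
      applies.\<close>
    define a b where "a = x - 1" and "b = x + 1"
    have e: "H y = H a + integral {a..y} \<psi>" if y: "y \<in> {a..b}" for y
    proof -
      have "H y = (\<integral>t. indicator {..a} t * \<psi> t + indicator {a<..y} t * \<psi> t \<partial>lborel)"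
        unfolding H_def using y by (intro Bochner_Integration.integral_cong) (auto simp: indicator_def)
      also have "\<dots> = H a + (\<integral>t. indicator {a<..y} t * \<psi> t \<partial>lborel)"
        unfolding H_def using ind \<psi>int by (subst Bochner_Integration.integral_add) auto
      also have "(\<integral>t. indicator {a<..y} t * \<psi> t \<partial>lborel) = (LINT t:{a..y}|lborel. \<psi> t)"
        unfolding set_lebesgue_integral_def
        by (rule integral_cong_AE) (use AE_lborel_singleton[of a] in \<open>auto simp: indicator_def elim!: eventually_mono\<close>)
      also have "\<dots> = integral {a..y} \<psi>"
        by (rule set_borel_integral_eq_integral) (auto simp: set_integrable_def ind \<psi>int)
      finally show ?thesis .
    qed
    have "((\<lambda>y. integral {a..y} \<psi>) has_real_derivative \<psi> x) (at x within {a..b})"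
      by (rule integral_has_real_derivative) (auto simp: a_def b_def intro: continuous_on_subset[OF \<psi>c])
    hence "((\<lambda>y. H a + integral {a..y} \<psi>) has_real_derivative \<psi> x) (at x within {a..b})"
      by (auto intro!: derivative_eq_intros)
    hence "(H has_real_derivative \<psi> x) (at x within {a..b})"
    proof (rule has_field_derivative_transform_within[where d=1])
      show "H a + integral {a..y} \<psi> = H y" if "y \<in> {a..b}" for y using e[OF that] by (rule sym)
    qed (auto simp: a_def b_def)
    thus ?thesis by (simp add: at_within_Icc_at a_def b_def)
  qed
  have bound: "\<bar>\<integral>t. indicator A t * \<psi> t \<partial>lborel\<bar> \<le> (\<integral>t. indicator A t * ?\<rho> t \<partial>lborel)" if "A \<in> sets borel" for A
  proof -
    have "\<bar>\<integral>t. indicator A t * \<psi> t \<partial>lborel\<bar> \<le> (\<integral>t. \<bar>indicator A t * \<psi> t\<bar> \<partial>lborel)" by (rule integral_abs_bound)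
    also have "\<dots> \<le> (\<integral>t. indicator A t * ?\<rho> t \<partial>lborel)"
      by (intro integral_mono integrable_abs ind that \<psi>int) (auto simp: indicator_def \<psi>le)
    finally show ?thesis .
  qed
  \<comment> \<open>For \<open>x \<ge> 0\<close> the left integral is useless, but
    \<open>\<psi>\<close> has total integral 0, so \<open>H x\<close> is minus the integral over the
    right tail. For \<open>x < 0\<close> the left tail is reflected to a right one.\<close>
  have xH: "\<bar>x * H x\<bar> \<le> ?\<rho> x" for x
  proof (cases "x \<ge> 0")
    case True
    have "(\<integral>t. \<psi> t \<partial>lborel) = (\<integral>t. indicator {..x} t * \<psi> t + indicator {x<..} t * \<psi> t \<partial>lborel)"
      by (intro Bochner_Integration.integral_cong) (auto simp: indicator_def)
    also have "\<dots> = H x + (\<integral>t. indicator {x<..} t * \<psi> t \<partial>lborel)"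
      unfolding H_def using ind \<psi>int by (subst Bochner_Integration.integral_add) auto
    finally have "\<bar>H x\<bar> = \<bar>\<integral>t. indicator {x<..} t * \<psi> t \<partial>lborel\<bar>" using \<psi>0 by simp
    also have "\<dots> \<le> (\<integral>t. indicator {x<..} t * ?\<rho> t \<partial>lborel)" by (rule bound) simp
    also have "\<dots> \<le> (\<integral>t. indicator {x..} t * ?\<rho> t \<partial>lborel)"
      by (intro integral_mono ind) (auto simp: indicator_def)
    finally have "x * \<bar>H x\<bar> \<le> x * (\<integral>t. indicator {x..} t * ?\<rho> t \<partial>lborel)" using True by (rule mult_left_mono)
    thus ?thesis using gaussian_tail_mills[OF True] True by (simp add: abs_mult)
  next
    case False
    have "\<bar>H x\<bar> \<le> (\<integral>t. indicator {..x} t * ?\<rho> t \<partial>lborel)" unfolding H_def by (rule bound) simp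
    also have "\<dots> = (\<integral>t. indicator {-x..} t * ?\<rho> t \<partial>lborel)"
      by (subst lborel_integral_real_affine[where c="-1" and t=0])
         (auto simp: indicator_def std_normal_density_def intro!: Bochner_Integration.integral_cong)
    finally have "(-x) * \<bar>H x\<bar> \<le> (-x) * (\<integral>t. indicator {-x..} t * ?\<rho> t \<partial>lborel)" using False by (intro mult_left_mono) auto
    also have "\<dots> \<le> ?\<rho> (-x)" using False by (intro gaussian_tail_mills) simp
    also have "\<dots> = ?\<rho> x" by (simp add: std_normal_density_def)
    finally show ?thesis using False by (simp add: abs_mult)
  qed
  define g where "g x = H x / ?\<rho> x" for x
  define g' where "g' x = h x - m + x * g x" for x
  have \<rho>pos: "?\<rho> x > 0" for x by (intro normal_density_pos) simp
  have d\<rho>: "(?\<rho> has_real_derivative - x * ?\<rho> x) (at x)" for x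
    unfolding std_normal_density_def by (auto intro!: derivative_eq_intros simp: field_simps)
  have dg: "(g has_real_derivative g' x) (at x)" for x
  proof -
    have "(g has_real_derivative (\<psi> x * ?\<rho> x - H x * (- x * ?\<rho> x)) / (?\<rho> x * ?\<rho> x)) (at x)"
      unfolding g_def using \<rho>pos[of x] by (intro DERIV_divide H d\<rho>) auto
    moreover have "(\<psi> x * ?\<rho> x - H x * (- x * ?\<rho> x)) / (?\<rho> x * ?\<rho> x) = g' x"
      using \<rho>pos[of x] unfolding g'_def g_def \<psi>_def by (simp add: field_simps)
    ultimately show ?thesis by simp
  qed
  have "continuous_on UNIV g" using dg by (meson DERIV_continuous_on DERIV_subset subset_UNIV)
  hence "continuous_on UNIV g'" unfolding g'_def by (intro continuous_intros h)
  moreover have "\<bar>g' x\<bar> \<le> 2" for x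
  proof -
    have "\<bar>x * g x\<bar> = \<bar>x * H x\<bar> / ?\<rho> x" unfolding g_def using \<rho>pos[of x] by (simp add: abs_mult)
    also have "\<dots> \<le> 1" using xH[of x] \<rho>pos[of x] by (simp add: divide_le_eq)
    finally show ?thesis unfolding g'_def using hm[of x] by linarith
  qed
  ultimately show ?thesis using that[of g g'] dg by (simp add: g'_def m_def)
qed

subsection \<open>Total variation distance\<close>

lemma borel_sandwich:
  fixes M :: "real measure"
  assumes "finite_measure M" "sets M = sets borel" "A \<in> sets borel" "\<delta> > 0"
  obtains K U where "compact K" "open U" "K \<subseteq> A" "A \<subseteq> U" "measure M U < measure M K + \<delta>"
proof -
  interpret finite_measure M by fact
  have fin: "emeasure M (space M) \<noteq> \<infinity>" by simp
  have "\<exists>K. compact K \<and> K \<subseteq> A \<and> measure M A < measure M K + \<delta> / 2"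
  proof (cases "measure M A < \<delta> / 2")
    \<comment> \<open>Here \<open>measure M A - \<delta> / 2\<close> is negative and would be
      truncated to 0 as an \<open>ennreal\<close>, so strictness could fail; the empty set does
      instead.\<close>
    case True
    thus ?thesis by (intro exI[of _ "{}"]) auto
  next
    case False
    have "ennreal (measure M A - \<delta> / 2) < emeasure M A"
      unfolding emeasure_eq_measure using assms False by (intro ennreal_lessI) auto
    also have "emeasure M A = (SUP K\<in>{K. K \<subseteq> A \<and> compact K}. emeasure M K)"
      by (rule inner_regular) (use assms fin in auto)
    finally obtain K where K: "K \<subseteq> A" "compact K" "ennreal (measure M A - \<delta> / 2) < emeasure M K"
      unfolding less_SUP_iff by auto
    thus ?thesis using False unfolding emeasure_eq_measure
      by (intro exI[of _ K]) (auto simp: ennreal_less_iff)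
  qed
  moreover have "\<exists>U. open U \<and> A \<subseteq> U \<and> measure M U < measure M A + \<delta> / 2"
  proof -
    have "emeasure M A < ennreal (measure M A + \<delta> / 2)"
      unfolding emeasure_eq_measure using assms by (intro ennreal_lessI) (auto simp: add_nonneg_pos)
    moreover have "emeasure M A = (INF U\<in>{U. A \<subseteq> U \<and> open U}. emeasure M U)"
      by (rule outer_regular) (use assms fin in auto)
    ultimately have "(INF U\<in>{U. A \<subseteq> U \<and> open U}. emeasure M U) < ennreal (measure M A + \<delta> / 2)" by metis
    then obtain U where U: "A \<subseteq> U" "open U" "emeasure M U < ennreal (measure M A + \<delta> / 2)"
      unfolding INF_less_iff by blast
    thus ?thesis unfolding emeasure_eq_measure by (intro exI[of _ U]) (auto simp: ennreal_less_iff)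
  qed
  ultimately show ?thesis using that by (smt (verit) field_sum_of_halves)
qed

text \<open>Comparing two measures requires one approximating pair for both; the union of the
  compact sets and the intersection of the open sets serve.\<close>

lemma borel_sandwich2:
  fixes M N :: "real measure"
  assumes M: "finite_measure M" "sets M = sets borel" and N: "finite_measure N" "sets N = sets borel"
    and A: "A \<in> sets borel" and "\<delta> > 0"
  obtains K U where "compact K" "open U" "K \<subseteq> A" "A \<subseteq> U"
    "measure M U < measure M K + \<delta>" "measure N U < measure N K + \<delta>"
proof -
  interpret M: finite_measure M by fact
  interpret N: finite_measure N by fact
  obtain K U where 1: "compact K" "open U" "K \<subseteq> A" "A \<subseteq> U" "measure M U < measure M K + \<delta>"
    using borel_sandwich[OF M A \<open>\<delta> > 0\<close>] by blast
  obtain L V where 2: "compact L" "open V" "L \<subseteq> A" "A \<subseteq> V" "measure N V < measure N L + \<delta>"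
    using borel_sandwich[OF N A \<open>\<delta> > 0\<close>] by blast
  have s: "K \<in> sets borel" "L \<in> sets borel" "U \<in> sets borel" "V \<in> sets borel"
    using 1 2 by (auto intro: borel_compact)
  have "measure M (U \<inter> V) \<le> measure M U" "measure M K \<le> measure M (K \<union> L)"
    "measure N (U \<inter> V) \<le> measure N V" "measure N L \<le> measure N (K \<union> L)"
    using s M N by (auto intro!: M.finite_measure_mono N.finite_measure_mono)
  thus ?thesis using 1 2 by (intro that[of "K \<union> L" "U \<inter> V"]) auto
qed

section \<open>From continuous test functions to Borel sets\<close>

lemma measure_diff_closed_le:
  fixes M N :: "real measure"
  assumes M: "prob_space M" "sets M = sets borel" and N: "prob_space N" "sets N = sets borel"
    and test: "\<And>h. continuous_on UNIV h \<Longrightarrow> (\<And>x. 0 \<le> h x) \<Longrightarrow> (\<And>x. h x \<le> 1) \<Longrightarrow> \<bar>(\<integral>x. h x \<partial>M) - (\<integral>x. h x \<partial>N)\<bar> \<le> \<epsilon>"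
    and C: "closed C"
  shows "\<bar>measure M C - measure N C\<bar> \<le> \<epsilon>"
proof (cases "C = {}")
  \<comment> \<open>\<open>infdist\<close> to the empty set is 0 by convention, so the cutoffs below
    would be constantly 1 rather than tend to the indicator.\<close>
  case True
  have "0 \<le> \<epsilon>" using test[of "\<lambda>_. 0"] by simp
  thus ?thesis using True by simp
next
  case False
  \<comment> \<open>Continuous cutoffs that equal 1 on \<open>C\<close> and decrease to its
    indicator; closedness makes the distance positive off \<open>C\<close>.\<close>
  define h where "h k x = max 0 (1 - real k * infdist x C)" for k :: nat and x :: real
  have hc: "continuous_on UNIV (h k)" for k unfolding h_def by (intro continuous_intros)
  have h01: "0 \<le> h k x" "h k x \<le> 1" for k x
    unfolding h_def using infdist_nonneg[of x C] by (auto simp: mult_nonneg_nonneg)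
  have hlim: "(\<lambda>k. h k x) \<longlonglongrightarrow> indicator C x" for x
  proof (cases "x \<in> C")
    case True
    thus ?thesis by (simp add: h_def)
  next
    case x: False
    have "infdist x C > 0" using x C False by (metis in_closed_iff_infdist_zero infdist_nonneg less_eq_real_def)
    then obtain k0 where k0: "1 < real k0 * infdist x C" using reals_Archimedean3 by blast
    have "h k x = indicator C x" if "k \<ge> k0" for k
    proof -
      have "real k0 * infdist x C \<le> real k * infdist x C" using that infdist_nonneg by (intro mult_right_mono) auto
      thus ?thesis using k0 x by (simp add: h_def)
    qed
    thus ?thesis by (intro tendsto_eventually eventually_sequentiallyI[of k0])
  qed
  have lim: "(\<lambda>k. \<integral>x. h k x \<partial>P) \<longlonglongrightarrow> measure P C" if P: "prob_space P" "sets P = sets borel" for P :: "real measure"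
  proof -
    interpret P: prob_space P by fact
    have mP: "measurable P borel = measurable borel borel" by (rule measurable_cong_sets) (simp_all add: P)
    have sp: "space P = UNIV" using sets_eq_imp_space_eq[OF P(2)] by simp
    have "(\<lambda>k. \<integral>x. h k x \<partial>P) \<longlonglongrightarrow> (\<integral>x. indicator C x \<partial>P)"
      by (rule integral_dominated_convergence[where w="\<lambda>_. 1"])
         (use hlim h01 C borel_measurable_continuous_onI[OF hc] in \<open>auto simp: mP\<close>)
    thus ?thesis using C P by (simp add: sp)
  qed
  have "(\<lambda>k. \<bar>(\<integral>x. h k x \<partial>M) - (\<integral>x. h k x \<partial>N)\<bar>) \<longlonglongrightarrow> \<bar>measure M C - measure N C\<bar>"
    by (intro tendsto_intros lim M N)
  thus ?thesis by (rule LIMSEQ_le_const2) (use test[OF hc h01] in blast)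
qed

text \<open>Indicators of Borel sets are not continuous, but each Borel set is approximated from
  inside by a compact set for both measures at once, and closed sets are reached by continuous
  functions.\<close>

lemma dTV_le:
  fixes M N :: "real measure"
  assumes M: "prob_space M" "sets M = sets borel" and N: "prob_space N" "sets N = sets borel"
    and test: "\<And>h. continuous_on UNIV h \<Longrightarrow> (\<And>x. 0 \<le> h x) \<Longrightarrow> (\<And>x. h x \<le> 1) \<Longrightarrow> \<bar>(\<integral>x. h x \<partial>M) - (\<integral>x. h x \<partial>N)\<bar> \<le> \<epsilon>"
  shows "dTV M N \<le> \<epsilon>"
  unfolding dTV_def
proof (rule cSup_least)
  interpret M: prob_space M by fact
  interpret N: prob_space N by fact
  fix y assume "y \<in> {\<bar>measure M A - measure N A\<bar> | A. A \<in> sets borel}"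
  then obtain A where A: "A \<in> sets borel" and y: "y = \<bar>measure M A - measure N A\<bar>" by auto
  show "y \<le> \<epsilon>"
  proof (rule field_le_epsilon)
    fix e :: real assume "e > 0"
    then obtain K U where K: "compact K" "open U" "K \<subseteq> A" "A \<subseteq> U"
      "measure M U < measure M K + e" "measure N U < measure N K + e"
      using borel_sandwich2[OF M.finite_measure_axioms M(2) N.finite_measure_axioms N(2) A] by blast
    have s: "K \<in> sets borel" "U \<in> sets borel" using K by (auto intro: borel_compact)
    have "measure M K \<le> measure M A" "measure M A \<le> measure M U" "measure N K \<le> measure N A" "measure N A \<le> measure N U"
      using s K A M N by (auto intro!: M.finite_measure_mono N.finite_measure_mono)
    moreover have "\<bar>measure M K - measure N K\<bar> \<le> \<epsilon>"
      using K by (intro measure_diff_closed_le[OF M N test] compact_imp_closed) auto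
    ultimately show "y \<le> \<epsilon> + e" unfolding y using K by linarith
  qed
qed auto

text \<open>The family consists of the finite unions of sets from a countable basis. It is chosen
  before the measures, so it serves for all coefficient vectors \<open>a\<close>
  simultaneously.\<close>

lemma dTV_countable:
  obtains \<U> :: "real set set" where "countable \<U>" "\<And>V. V \<in> \<U> \<Longrightarrow> V \<in> sets borel"
    "\<And>M N. prob_space M \<Longrightarrow> sets M = sets borel \<Longrightarrow> prob_space N \<Longrightarrow> sets N = sets borel \<Longrightarrow>
      dTV M N = (SUP V\<in>\<U>. \<bar>measure M V - measure N V\<bar>)"
proof -
  obtain B :: "real set set" where B: "countable B" "topological_basis B" using ex_countable_basis by auto
  define \<U> where "\<U> = Union ` {F. finite F \<and> F \<subseteq> B}"
  have c: "countable \<U>" unfolding \<U>_def using countable_Collect_finite_subset[OF B(1)] by (simp add: conj_commute)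
  have o: "open V" if "V \<in> \<U>" for V
    using that topological_basis_open[OF B(2)] unfolding \<U>_def by (auto intro!: open_Union)
  have ne: "{} \<in> \<U>" unfolding \<U>_def by (auto intro!: image_eqI[of _ _ "{}"])
  have eq: "dTV M N = (SUP V\<in>\<U>. \<bar>measure M V - measure N V\<bar>)"
    if M: "prob_space M" "sets M = sets borel" and N: "prob_space N" "sets N = sets borel" for M N
  proof (rule antisym)
    interpret M: prob_space M by fact
    interpret N: prob_space N by fact
    have le1: "\<bar>measure M A - measure N A\<bar> \<le> 1" for A
      using M.prob_le_1[of A] N.prob_le_1[of A] measure_nonneg[of M A] measure_nonneg[of N A] by linarith
    have bdd: "bdd_above ((\<lambda>V. \<bar>measure M V - measure N V\<bar>) ` S)" for S
      by (rule bdd_aboveI[of _ 1]) (auto simp: le1)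
    show "dTV M N \<le> (SUP V\<in>\<U>. \<bar>measure M V - measure N V\<bar>)"
      unfolding dTV_def
    proof (rule cSup_least)
      fix y assume "y \<in> {\<bar>measure M A - measure N A\<bar> | A. A \<in> sets borel}"
      then obtain A where A: "A \<in> sets borel" and y: "y = \<bar>measure M A - measure N A\<bar>" by auto
      show "y \<le> (SUP V\<in>\<U>. \<bar>measure M V - measure N V\<bar>)"
      proof (rule field_le_epsilon)
        fix e :: real assume "e > 0"
        hence "e / 2 > 0" by simp
        then obtain K U where K: "compact K" "open U" "K \<subseteq> A" "A \<subseteq> U"
          "measure M U < measure M K + e / 2" "measure N U < measure N K + e / 2"
          using borel_sandwich2[OF M.finite_measure_axioms M(2) N.finite_measure_axioms N(2) A] by blast
        \<comment> \<open>Compactness of \<open>K\<close> selects finitely many of the basis sets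
          that make up \<open>U\<close>. Their union lies between \<open>K\<close> and
          \<open>U\<close>, as \<open>A\<close> does, so it replaces \<open>A\<close> up to
          \<open>e / 2\<close> in each measure.\<close>
        obtain B' where B': "B' \<subseteq> B" "\<Union>B' = U" using B(2) K(2) unfolding topological_basis_def by blast
        obtain F where F: "F \<subseteq> B'" "finite F" "K \<subseteq> \<Union>F"
          using compactE[OF K(1), of B'] B' K topological_basis_open[OF B(2)] by (metis subset_iff subset_trans)
        define V where "V = \<Union>F"
        have V: "V \<in> \<U>" unfolding V_def \<U>_def using F B' by auto
        have KV: "K \<subseteq> V" "V \<subseteq> U" using F B' by (auto simp: V_def)
        have s: "K \<in> sets borel" "U \<in> sets borel" "V \<in> sets borel" using K o[OF V] by (auto intro: borel_compact)
        have "measure M K \<le> measure M A" "measure M A \<le> measure M U" "measure N K \<le> measure N A" "measure N A \<le> measure N U"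
          "measure M K \<le> measure M V" "measure M V \<le> measure M U" "measure N K \<le> measure N V" "measure N V \<le> measure N U"
          using s K A M N KV by (auto intro!: M.finite_measure_mono N.finite_measure_mono)
        hence "y \<le> \<bar>measure M V - measure N V\<bar> + e" unfolding y using K by linarith
        also have "\<bar>measure M V - measure N V\<bar> \<le> (SUP V\<in>\<U>. \<bar>measure M V - measure N V\<bar>)"
          by (rule cSUP_upper[OF V bdd])
        finally show "y \<le> (SUP V\<in>\<U>. \<bar>measure M V - measure N V\<bar>) + e" by simp
      qed
    qed auto
    show "(SUP V\<in>\<U>. \<bar>measure M V - measure N V\<bar>) \<le> dTV M N"
    proof (rule cSUP_least)
      fix V assume "V \<in> \<U>"
      hence "V \<in> sets borel" using o by simp
      moreover have "bdd_above {\<bar>measure M A - measure N A\<bar> | A. A \<in> sets borel}"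
        by (rule bdd_aboveI[of _ 1]) (auto simp: le1)
      ultimately show "\<bar>measure M V - measure N V\<bar> \<le> dTV M N" unfolding dTV_def
        by (intro cSup_upper) blast+
    qed (use ne in auto)
  qed
  show ?thesis by (rule that[OF c _ eq]) (use o in auto)
qed

subsection \<open>Normal approximation of zonal sums\<close>

lemma dTV_bounds:
  assumes "prob_space M" "prob_space N"
  shows "0 \<le> dTV M N" "dTV M N \<le> 1"
proof -
  interpret M: prob_space M by fact
  interpret N: prob_space N by fact
  have le1: "\<bar>measure M A - measure N A\<bar> \<le> 1" for A
    using M.prob_le_1[of A] N.prob_le_1[of A] measure_nonneg[of M A] measure_nonneg[of N A] by linarith
  have "bdd_above {\<bar>measure M A - measure N A\<bar> | A. A \<in> sets borel}"
    by (rule bdd_aboveI[of _ 1]) (auto simp: le1)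
  moreover have "0 \<in> {\<bar>measure M A - measure N A\<bar> | A. A \<in> sets borel}"
    by (auto intro!: exI[of _ "{}"])
  ultimately show "0 \<le> dTV M N" unfolding dTV_def by (intro cSup_upper)
  show "dTV M N \<le> 1" unfolding dTV_def by (rule cSup_least) (auto simp: le1)
qed

lemma harm_sum_eq_poly: "n \<ge> 3 \<Longrightarrow> harm_sum n l a x = (\<Sum>i<n. a i * poly (zonal_poly n l) (x i))"
  by (simp add: harm_sum_def zonal_eq_poly)

lemma sphere_bounded_harm_sum:
  assumes "n \<ge> 3" shows "sphere_bounded n (harm_sum n l a)"
proof -
  have "harm_sum n l a = (\<lambda>x. \<Sum>i<n. a i * poly (zonal_poly n l) (x i))"
    using harm_sum_eq_poly[OF assms] by (intro ext)
  moreover have "sphere_bounded n (\<lambda>x. \<Sum>i<n. a i * poly (zonal_poly n l) (x i))"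
    by (intro sphere_bounded_intros) auto
  ultimately show ?thesis by simp
qed

lemma prob_space_distr_harm_sum:
  assumes "n \<ge> 3" shows "prob_space (distr (sphere_unif n) borel (harm_sum n l a))"
proof -
  interpret prob_space "sphere_unif n" using assms by (intro prob_space_sphere_unif) simp
  show ?thesis by (rule prob_space_distr) (use sphere_bounded_measurable[OF sphere_bounded_harm_sum[OF assms]] in simp)
qed

lemma prob_space_std_normal: "prob_space std_normal_distribution"
  by (rule prob_space_normal_density) simp

text \<open>Evaluating Stein's equation at \<open>P\<close> and eliminating \<open>P * g (P)\<close>
  by the Stein identity leaves the mean of \<open>g' (P) * (1 - W / \<mu>)\<close>. The factor 2 is
  the bound on \<open>g'\<close>, the same for every test function.\<close>

lemma dTV_harm_sum_le:
  fixes n l :: nat and a :: "nat \<Rightarrow> real"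
  defines "f \<equiv> pderiv (zonal_poly n l)"
  assumes n: "n \<ge> 3" and l: "l \<ge> 1"
  shows "dTV (distr (sphere_unif n) borel (harm_sum n l a)) std_normal_distribution
    \<le> 2 * (\<integral>x. \<bar>1 - ((\<Sum>k<n. (a k)\<^sup>2 * (poly f (x k))\<^sup>2) - (\<Sum>k<n. a k * x k * poly f (x k))\<^sup>2)
         / (real l * (real n + real l - 2))\<bar> \<partial>sphere_unif n)"
proof (rule dTV_le)
  let ?S = "sphere_unif n" and ?N = std_normal_distribution
  have n0: "n > 0" using n by simp
  interpret prob_space ?S by (rule prob_space_sphere_unif[OF n0])
  define \<mu> where "\<mu> = real l * (real n + real l - 2)"
  have mu: "\<mu> > 0" unfolding \<mu>_def using n l by (intro mult_pos_pos) auto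
  define P where "P x = (\<Sum>i<n. a i * poly (zonal_poly n l) (x i))" for x
  define W where "W x = (\<Sum>k<n. (a k)\<^sup>2 * (poly f (x k))\<^sup>2) - (\<Sum>k<n. a k * x k * poly f (x k))\<^sup>2" for x
  have PH: "harm_sum n l a = P" using n by (auto simp: harm_sum_eq_poly P_def)
  note nice = sphere_bounded_intros
  have P: "sphere_bounded n P" unfolding P_def by (intro nice) auto
  have W: "sphere_bounded n W" unfolding W_def by (intro nice) auto
  fix h :: "real \<Rightarrow> real"
  assume h: "continuous_on UNIV h" "\<And>x. 0 \<le> h x" "\<And>x. h x \<le> 1"
  obtain g g' where g: "\<And>y. (g has_real_derivative g' y) (at y)" "continuous_on UNIV g'" "\<And>y. \<bar>g' y\<bar> \<le> 2"
    "\<And>y. g' y - y * g y = h y - (\<integral>z. h z \<partial>?N)"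
    using stein_equation[OF h] by blast
  have gc: "continuous_on UNIV g" using g(1) by (meson DERIV_continuous_on DERIV_subset subset_UNIV)
  note nice = nice sphere_bounded_continuous[OF gc] sphere_bounded_continuous[OF g(2)] sphere_bounded_continuous[OF h(1)]
  note int = integrable_sphere_bounded[OF n0]
  have i: "integrable ?S (\<lambda>x. h (P x))" "integrable ?S (\<lambda>x. g' (P x))" "integrable ?S (\<lambda>x. P x * g (P x))"
    "integrable ?S (\<lambda>x. g' (P x) * W x)" "integrable ?S (\<lambda>x. g' (P x) * (1 - W x / \<mu>))" "integrable ?S (\<lambda>x. \<bar>1 - W x / \<mu>\<bar>)"
    using P W by (intro int nice; simp)+
  have "\<mu> * (\<integral>x. P x * g (P x) \<partial>?S) = (\<integral>x. g' (P x) * W x \<partial>?S)"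
    unfolding P_def W_def f_def
    by (rule stein_identity[OF n0 _ g(1,2)]) (simp add: zonal_poly_ode \<mu>_def)
  hence id: "(\<integral>x. P x * g (P x) \<partial>?S) = (\<integral>x. g' (P x) * W x \<partial>?S) / \<mu>" using mu by (simp add: field_simps)
  have "(\<integral>y. h y \<partial>distr ?S borel P) - (\<integral>z. h z \<partial>?N) = (\<integral>x. h (P x) \<partial>?S) - (\<integral>z. h z \<partial>?N)"
    using sphere_bounded_measurable[OF P] borel_measurable_continuous_onI[OF h(1)] by (subst integral_distr) auto
  also have "\<dots> = (\<integral>x. h (P x) - (\<integral>z. h z \<partial>?N) \<partial>?S)" using i(1) prob_space by (simp del: sphere_unif_simps)
  also have "\<dots> = (\<integral>x. g' (P x) - P x * g (P x) \<partial>?S)" by (simp only: g(4))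
  also have "\<dots> = (\<integral>x. g' (P x) \<partial>?S) - (\<integral>x. g' (P x) * W x \<partial>?S) / \<mu>" using i by (simp add: id)
  also have "\<dots> = (\<integral>x. g' (P x) - g' (P x) * W x / \<mu> \<partial>?S)" using i by simp
  also have "\<dots> = (\<integral>x. g' (P x) * (1 - W x / \<mu>) \<partial>?S)" by (simp add: right_diff_distrib)
  finally have "\<bar>(\<integral>y. h y \<partial>distr ?S borel P) - (\<integral>z. h z \<partial>?N)\<bar> = \<bar>\<integral>x. g' (P x) * (1 - W x / \<mu>) \<partial>?S\<bar>" by simp
  also have "\<dots> \<le> (\<integral>x. \<bar>g' (P x) * (1 - W x / \<mu>)\<bar> \<partial>?S)" by (rule integral_abs_bound)
  also have "\<dots> \<le> (\<integral>x. 2 * \<bar>1 - W x / \<mu>\<bar> \<partial>?S)"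
  proof (rule integral_mono)
    show "integrable ?S (\<lambda>x. \<bar>g' (P x) * (1 - W x / \<mu>)\<bar>)" using i(5) by (rule integrable_abs)
    show "integrable ?S (\<lambda>x. 2 * \<bar>1 - W x / \<mu>\<bar>)" using i(6) by simp
    show "\<bar>g' (P x) * (1 - W x / \<mu>)\<bar> \<le> 2 * \<bar>1 - W x / \<mu>\<bar>" for x
      unfolding abs_mult by (rule mult_right_mono[OF g(3)]) simp
  qed
  also have "\<dots> = 2 * (\<integral>x. \<bar>1 - W x / \<mu>\<bar> \<partial>?S)" by simp
  finally show "\<bar>(\<integral>y. h y \<partial>distr ?S borel (harm_sum n l a)) - (\<integral>z. h z \<partial>?N)\<bar>
    \<le> 2 * (\<integral>x. \<bar>1 - ((\<Sum>k<n. (a k)\<^sup>2 * (poly f (x k))\<^sup>2) - (\<Sum>k<n. a k * x k * poly f (x k))\<^sup>2)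
         / (real l * (real n + real l - 2))\<bar> \<partial>?S)"
    unfolding PH by (simp only: W_def \<mu>_def)
qed (simp_all add: prob_space_distr_harm_sum[OF n] prob_space_std_normal)

section \<open>Random coefficient vectors\<close>

lemma borel_measurable_dTV_harm_sum:
  assumes n: "n \<ge> 3"
  shows "(\<lambda>a. dTV (distr (sphere_unif n) borel (harm_sum n l a)) std_normal_distribution)
    \<in> borel_measurable (PiM {..<n} (\<lambda>_. borel))"
proof -
  let ?S = "sphere_unif n" and ?N = std_normal_distribution and ?B = "PiM {..<n} (\<lambda>_. borel :: real measure)"
  interpret S: prob_space ?S using n by (intro prob_space_sphere_unif) simp
  interpret N: prob_space ?N by (rule prob_space_std_normal)
  obtain \<U> :: "real set set" where U: "countable \<U>" "\<And>V. V \<in> \<U> \<Longrightarrow> V \<in> sets borel"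
    "\<And>M N. prob_space M \<Longrightarrow> sets M = sets borel \<Longrightarrow> prob_space N \<Longrightarrow> sets N = sets borel \<Longrightarrow>
      dTV M N = (SUP V\<in>\<U>. \<bar>measure M V - measure N V\<bar>)"
    by (rule dTV_countable) blast
  have eq: "dTV (distr ?S borel (harm_sum n l a)) ?N = (SUP V\<in>\<U>. \<bar>measure (distr ?S borel (harm_sum n l a)) V - measure ?N V\<bar>)" for a
    by (rule U(3)) (simp_all add: prob_space_distr_harm_sum[OF n] prob_space_std_normal)
  have sets: "sets (?B \<Otimes>\<^sub>M ?S) = sets (?B \<Otimes>\<^sub>M ?B)" by (rule sets_pair_measure_cong) auto
  have [measurable]: "(\<lambda>(a, x). harm_sum n l a x) \<in> borel_measurable (?B \<Otimes>\<^sub>M ?S)"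
  proof -
    have [measurable]: "poly p \<in> borel_measurable borel" for p :: "real poly"
      by (rule borel_measurable_continuous_onI[OF continuous_on_poly_UNIV])
    have "(\<lambda>(a, x). harm_sum n l a x) \<in> borel_measurable (?B \<Otimes>\<^sub>M ?B)"
      unfolding harm_sum_eq_poly[OF n] by measurable
    thus ?thesis unfolding measurable_cong_sets[OF sets refl] .
  qed
  show ?thesis unfolding eq
  proof (rule borel_measurable_cSUP[OF U(1)])
    fix V assume "V \<in> \<U>"
    note [measurable] = U(2)[OF this]
    \<comment> \<open>Written as an integral over \<open>x\<close> of a jointly measurable function
      of \<open>a\<close> and \<open>x\<close>, the probability of a fixed \<open>V\<close> is
      measurable in \<open>a\<close>.\<close>
    have "measure (distr ?S borel (harm_sum n l a)) V = (\<integral>x. indicator V (harm_sum n l a x) \<partial>?S)" for a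
    proof -
      have m: "harm_sum n l a \<in> measurable ?S borel"
        using sphere_bounded_measurable[OF sphere_bounded_harm_sum[OF n]] by simp
      have "measure (distr ?S borel (harm_sum n l a)) V = (\<integral>y. indicator V y \<partial>distr ?S borel (harm_sum n l a))"
        by (simp add: U(2)[OF \<open>V \<in> \<U>\<close>])
      also have "\<dots> = (\<integral>x. indicator V (harm_sum n l a x) \<partial>?S)" by (rule integral_distr[OF m]) measurable
      finally show ?thesis .
    qed
    moreover have "(\<lambda>a. \<integral>x. (indicator V (harm_sum n l a x) :: real) \<partial>?S) \<in> borel_measurable ?B"
      by (rule S.borel_measurable_lebesgue_integral) measurable
    ultimately have "(\<lambda>a. measure (distr ?S borel (harm_sum n l a)) V) \<in> borel_measurable ?B" by simp
    thus "(\<lambda>a. \<bar>measure (distr ?S borel (harm_sum n l a)) V - measure ?N V\<bar>) \<in> borel_measurable ?B"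
      by (intro borel_measurable_abs borel_measurable_diff) auto
  next
    fix a
    interpret M: prob_space "distr ?S borel (harm_sum n l a)" by (rule prob_space_distr_harm_sum[OF n])
    have "\<bar>measure (distr ?S borel (harm_sum n l a)) V - measure ?N V\<bar> \<le> 1" for V
      using M.prob_le_1[of V] N.prob_le_1[of V] measure_nonneg[of "distr ?S borel (harm_sum n l a)" V] measure_nonneg[of ?N V] by linarith
    thus "bdd_above ((\<lambda>V. \<bar>measure (distr ?S borel (harm_sum n l a)) V - measure ?N V\<bar>) ` \<U>)"
      by (intro bdd_aboveI[of _ 1]) auto
  qed
qed

text \<open>By Cauchy-Schwarz it is enough to average the fourth powers. Each has mean
  \<open>3 / (n * (n + 2))\<close>, so their sum has mean at most \<open>3 / n\<close>, which gives
  the rate \<open>1 / sqrt n\<close>.\<close>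

lemma integral_sqrt_sum_power4:
  assumes "n \<ge> 3"
  shows "integrable (sphere_unif n) (\<lambda>a. sqrt (\<Sum>i<n. (a i)^4))"
    "(\<integral>a. sqrt (\<Sum>i<n. (a i)^4) \<partial>sphere_unif n) \<le> sqrt 3 / sqrt (real n)"
proof -
  have n: "n > 0" using assms by simp
  have b: "sphere_bounded n (\<lambda>a. sqrt (\<Sum>i<n. (a i)^4))"
    by (rule sphere_bounded_continuous[of sqrt]) (auto intro!: continuous_intros sphere_bounded_intros)
  show i: "integrable (sphere_unif n) (\<lambda>a. sqrt (\<Sum>i<n. (a i)^4))"
    by (rule integrable_sphere_bounded[OF n b])
  have nn: "0 \<le> (\<Sum>i<n. (a i)^4)" for a :: "nat \<Rightarrow> real" by (intro sum_nonneg) auto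
  have m4: "sph_mom (real n) 4 = 3 / (real n + 2) * (1 / real n)" by (simp add: numeral_eq_Suc)
  have "(\<integral>a. (\<Sum>i<n. (a i)^4) \<partial>sphere_unif n) = (\<Sum>i<n. \<integral>a. (a i)^4 \<partial>sphere_unif n)"
    by (intro Bochner_Integration.integral_sum integrable_sphere_bounded[OF n] sphere_bounded_intros) auto
  also have "\<dots> = (\<Sum>i<n. 3 / (real n + 2) * (1 / real n))"
    using assms by (intro sum.cong) (auto simp: integral_coord_power m4)
  also have "\<dots> = 3 / (real n + 2)" using n by simp
  also have "\<dots> \<le> 3 / real n" using n by (intro divide_left_mono) auto
  finally have "(\<integral>a. (sqrt (\<Sum>i<n. (a i)^4))\<^sup>2 \<partial>sphere_unif n) \<le> 3 / real n" by (simp add: nn)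
  from integral_abs_le_sqrt[OF n b this] show "(\<integral>a. sqrt (\<Sum>i<n. (a i)^4) \<partial>sphere_unif n) \<le> sqrt 3 / sqrt (real n)"
    by (simp add: nn real_sqrt_divide)
qed

text \<open>The root of the sum of fourth powers is the squared 4-norm. Integrability is asserted
  along with the averaged bound because the integral of a non-integrable function is 0 by
  convention, which would make that bound empty.\<close>

theorem theorem3p4:
  fixes l :: nat
  assumes "odd l"
  shows "(\<exists>c::real. \<forall>n\<ge>3. \<forall>a :: nat \<Rightarrow> real. (\<Sum>i<n. (a i)^2) = 1 \<longrightarrow>
            dTV (distr (sphere_unif n) borel (harm_sum n l a)) std_normal_distribution
              \<le> c * sqrt (\<Sum>i<n. (a i)^4))
       \<and> (\<exists>c'::real. \<forall>n\<ge>3.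
            integrable (sphere_unif n)
              (\<lambda>a. dTV (distr (sphere_unif n) borel (harm_sum n l a)) std_normal_distribution)
          \<and> (\<integral>a. dTV (distr (sphere_unif n) borel (harm_sum n l a)) std_normal_distribution
                \<partial>sphere_unif n) \<le> c' / sqrt (real n))"
proof -
  let ?d = "\<lambda>n a. dTV (distr (sphere_unif n) borel (harm_sum n l a)) std_normal_distribution"
  have l: "l \<ge> 1" using assms by (cases l) auto
  obtain C where C: "C \<ge> 0" "\<And>n a. n \<ge> 3 \<Longrightarrow> (\<Sum>i<n. (a i)\<^sup>2) = 1 \<Longrightarrow>
      (\<integral>x. \<bar>1 - ((\<Sum>k<n. (a k)\<^sup>2 * (poly (pderiv (zonal_poly n l)) (x k))\<^sup>2)
           - (\<Sum>k<n. a k * x k * poly (pderiv (zonal_poly n l)) (x k))\<^sup>2) / (real l * (real n + real l - 2))\<bar> \<partial>sphere_unif n)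
      \<le> C * sqrt (\<Sum>i<n. (a i)^4)"
    by (rule gradient_norm_concentration[OF assms]) blast
  have bound: "?d n a \<le> 2 * C * sqrt (\<Sum>i<n. (a i)^4)" if "n \<ge> 3" "(\<Sum>i<n. (a i)\<^sup>2) = 1" for n a
    using dTV_harm_sum_le[OF that(1) l, of a] C(2)[OF that] by linarith
  have avg: "integrable (sphere_unif n) (?d n) \<and> (\<integral>a. ?d n a \<partial>sphere_unif n) \<le> (2 * C * sqrt 3) / sqrt (real n)" if n: "n \<ge> 3" for n
  proof
    interpret prob_space "sphere_unif n" using n by (intro prob_space_sphere_unif) simp
    have "0 \<le> ?d n a" "?d n a \<le> 1" for a
      using dTV_bounds[OF prob_space_distr_harm_sum[OF n] prob_space_std_normal] by auto
    thus i: "integrable (sphere_unif n) (?d n)"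
      using borel_measurable_dTV_harm_sum[OF n] by (intro integrable_const_bound[where B=1]) auto
    have "(\<integral>a. ?d n a \<partial>sphere_unif n) \<le> (\<integral>a. 2 * C * sqrt (\<Sum>i<n. (a i)^4) \<partial>sphere_unif n)"
    proof (rule integral_mono_AE)
      \<comment> \<open>The fixed-vector bound is available only for unit vectors, hence almost
        everywhere.\<close>
      show "AE a in sphere_unif n. ?d n a \<le> 2 * C * sqrt (\<Sum>i<n. (a i)^4)"
        using AE_sphere_unif[of n] n by (auto intro: bound)
    qed (use i integral_sqrt_sum_power4(1)[OF n] in auto)
    also have "\<dots> = 2 * C * (\<integral>a. sqrt (\<Sum>i<n. (a i)^4) \<partial>sphere_unif n)" by simp
    also have "\<dots> \<le> 2 * C * (sqrt 3 / sqrt (real n))"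
      using C(1) integral_sqrt_sum_power4(2)[OF n] by (intro mult_left_mono) auto
    finally show "(\<integral>a. ?d n a \<partial>sphere_unif n) \<le> (2 * C * sqrt 3) / sqrt (real n)" by simp
  qed
  show ?thesis
  proof (rule conjI)
    show "\<exists>c. \<forall>n\<ge>3. \<forall>a. (\<Sum>i<n. (a i)\<^sup>2) = 1 \<longrightarrow> ?d n a \<le> c * sqrt (\<Sum>i<n. (a i)^4)"
      by (intro exI[of _ "2 * C"] allI impI bound)
    show "\<exists>c'. \<forall>n\<ge>3. integrable (sphere_unif n) (?d n) \<and> (\<integral>a. ?d n a \<partial>sphere_unif n) \<le> c' / sqrt (real n)"
      by (intro exI[of _ "2 * C * sqrt 3"] allI impI avg)
  qed
qed

end
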